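(* Let $p$ be a prime, $\alpha\ge3$ an integer, and $M_{p^\alpha}=\langle a,b\mid a^{p^{\alpha-1}}=b^p=1,\ bab^{-1}=a^{1+p^{\alpha-2}}\rangle$ the modular group of order $p^\alpha$. Then (i) $\Gamma_N(M_{p^\alpha})\cong 2K_2$ if $p^\alpha=8$, and $\Gamma_N(M_{p^\alpha})\cong K_p$ otherwise; (ii) $\Gamma(M_{p^\alpha})\cong K_4+2K_2$ if $p^\alpha=8$, and $\Gamma(M_{p^\alpha})\cong K_{(\alpha-1)(p+1)}$ otherwise.
   Context: For a group $G$, $\Gamma(G)$ is the simple graph whose vertices are the subgroups of $G$ other than $\{1\}$ and $G$, and $\Gamma_N(G)$ is the simple graph whose vertices are the proper non-normal subgroups of $G$; in both, two distinct vertices $H,K$ are adjacent iff $HK=KH$. $K_m$ is the complete graph on $m$ vertices, $2K_2$ the disjoint union of two copies of $K_2$, and $G_1+G_2$ the join (disjoint union plus all edges between $G_1$ and $G_2$). *)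

theory Defs
  imports
    "HOL-Algebra.Coset"
    "HOL-Computational_Algebra.Primes"
    "Graph_Theory.Pair_Digraph"
    "Graph_Theory.Digraph_Isomorphism"
begin

section \<open>Groups given by generators and relations\<close>

text \<open>
  A letter \<open>(x, True)\<close> stands for the generator \<open>x\<close> and \<open>(x, False)\<close> for its inverse.
  A pair \<open>(u, v)\<close> of words stands for the relation \<open>u = v\<close>. The generators of the group are
  all elements of the type of generators.
\<close>

type_synonym 'g word = "('g \<times> bool) list"

inductive word_eq :: "('g word \<times> 'g word) set \<Rightarrow> 'g word \<Rightarrow> 'g word \<Rightarrow> bool"
  for R :: "('g word \<times> 'g word) set" where
  refl: "word_eq R u u"
| sym: "word_eq R u v \<Longrightarrow> word_eq R v u"
| trans: "word_eq R u v \<Longrightarrow> word_eq R v w \<Longrightarrow> word_eq R u w"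
| append: "word_eq R u u' \<Longrightarrow> word_eq R v v' \<Longrightarrow> word_eq R (u @ v) (u' @ v')"
| cancel: "word_eq R [(x, s), (x, \<not> s)] []"
| relation: "(u, v) \<in> R \<Longrightarrow> word_eq R u v"

definition word_class :: "('g word \<times> 'g word) set \<Rightarrow> 'g word \<Rightarrow> 'g word set" where
  "word_class R u = {v. word_eq R u v}"

definition presented_group :: "('g word \<times> 'g word) set \<Rightarrow> 'g word set monoid" where
  "presented_group R =
     \<lparr>carrier = range (word_class R),
      monoid.mult = (\<lambda>X Y. \<Union>u\<in>X. \<Union>v\<in>Y. word_class R (u @ v)),
      monoid.one = word_class R []\<rparr>"

lemma word_class_eq_iff: "word_class R u = word_class R v \<longleftrightarrow> word_eq R u v"
proof
  assume "word_class R u = word_class R v"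
  then show "word_eq R u v"
    unfolding word_class_def using word_eq.refl[of R v] by blast
next
  assume uv: "word_eq R u v"
  have "word_eq R u w \<longleftrightarrow> word_eq R v w" for w
    using word_eq.trans[OF uv, of w] word_eq.trans[OF word_eq.sym[OF uv], of w] by blast
  then show "word_class R u = word_class R v"
    by (simp add: word_class_def)
qed

lemma presented_group_simps [simp]:
  "carrier (presented_group R) = range (word_class R)"
  "\<one>\<^bsub>presented_group R\<^esub> = word_class R []"
  "word_class R u \<otimes>\<^bsub>presented_group R\<^esub> word_class R v = word_class R (u @ v)"
proof -
  have "word_class R (u' @ v') = word_class R (u @ v)"
    if "u' \<in> word_class R u" "v' \<in> word_class R v" for u' v'
    using that unfolding word_class_eq_iff
    by (simp add: word_class_def word_eq.sym word_eq.append)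
  then have "(\<Union>u'\<in>word_class R u. \<Union>v'\<in>word_class R v. word_class R (u' @ v')) =
      (\<Union>u'\<in>word_class R u. \<Union>v'\<in>word_class R v. word_class R (u @ v))"
    by (intro SUP_cong HOL.refl) blast
  also have "\<dots> = word_class R (u @ v)"
    using word_eq.refl[of R u] word_eq.refl[of R v] unfolding word_class_def by blast
  finally show "word_class R u \<otimes>\<^bsub>presented_group R\<^esub> word_class R v = word_class R (u @ v)"
    by (simp add: presented_group_def)
qed (simp_all add: presented_group_def)

fun inv_word :: "'g word \<Rightarrow> 'g word" where
  "inv_word [] = []"
| "inv_word ((x, s) # u) = inv_word u @ [(x, \<not> s)]"

lemma word_eq_inv_word: "word_eq R (inv_word u @ u) []"
proof (induction u rule: inv_word.induct)
  case (2 x s u)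
  have "word_eq R (inv_word u @ ([(x, \<not> s), (x, \<not> \<not> s)] @ u)) (inv_word u @ ([] @ u))"
    by (intro word_eq.append word_eq.refl word_eq.cancel)
  then have "word_eq R (inv_word ((x, s) # u) @ (x, s) # u) (inv_word u @ u)" by simp
  then show ?case by (rule word_eq.trans) (rule 2)
qed (simp add: word_eq.refl)

lemma group_presented_group: "group (presented_group R)"
proof (rule groupI)
  fix X assume "X \<in> carrier (presented_group R)"
  then obtain u where "X = word_class R u" by auto
  then show "\<exists>Y\<in>carrier (presented_group R). Y \<otimes>\<^bsub>presented_group R\<^esub> X = \<one>\<^bsub>presented_group R\<^esub>"
    by (intro bexI[of _ "word_class R (inv_word u)"])
      (auto simp: word_class_eq_iff word_eq_inv_word)
qed auto

primrec eval_word :: "('a, 'b) monoid_scheme \<Rightarrow> ('g \<Rightarrow> 'a) \<Rightarrow> 'g word \<Rightarrow> 'a" where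
  "eval_word G f [] = \<one>\<^bsub>G\<^esub>"
| "eval_word G f (l # u) = (if snd l then f (fst l) else inv\<^bsub>G\<^esub> f (fst l)) \<otimes>\<^bsub>G\<^esub> eval_word G f u"

text \<open>The universal property of the presentation (von Dyck's theorem).\<close>

lemma presented_group_universal:
  assumes G: "group G" and f: "range f \<subseteq> carrier G"
    and R: "\<And>u v. (u, v) \<in> R \<Longrightarrow> eval_word G f u = eval_word G f v"
  shows "\<exists>h \<in> hom (presented_group R) G. \<forall>x. h (word_class R [(x, True)]) = f x"
proof -
  interpret group G by (rule G)
  have f' [simp]: "f x \<in> carrier G" for x using f by auto
  have cl [simp]: "eval_word G f u \<in> carrier G" for u by (induction u) auto
  have app: "eval_word G f (u @ v) = eval_word G f u \<otimes>\<^bsub>G\<^esub> eval_word G f v" for u v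
    by (induction u) (auto simp: m_assoc)
  have eq: "word_eq R u v \<Longrightarrow> eval_word G f u = eval_word G f v" for u v
    by (induction rule: word_eq.induct) (auto simp: app R)
  define h where "h X = eval_word G f (SOME u. u \<in> X)" for X
  have h: "h (word_class R u) = eval_word G f u" for u
  proof -
    have "word_eq R u (SOME v. word_eq R u v)"
      by (rule someI[of _ u]) (rule word_eq.refl)
    then show ?thesis by (simp add: h_def word_class_def eq)
  qed
  show ?thesis
    by (rule bexI[of _ h]) (auto simp: h app hom_def)
qed


section \<open>The modular groups\<close>

datatype modular_gen = Gen_a | Gen_b

definition modular_relations :: "nat \<Rightarrow> nat \<Rightarrow> (modular_gen word \<times> modular_gen word) set" where
  "modular_relations p \<alpha> =
     {(replicate (p ^ (\<alpha> - 1)) (Gen_a, True), []),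
      (replicate p (Gen_b, True), []),
      ([(Gen_b, True), (Gen_a, True), (Gen_b, False)],
       replicate (1 + p ^ (\<alpha> - 2)) (Gen_a, True))}"

definition modular_group :: "nat \<Rightarrow> nat \<Rightarrow> modular_gen word set monoid" where
  "modular_group p \<alpha> = presented_group (modular_relations p \<alpha>)"


section \<open>Permutability graphs of subgroups\<close>

text \<open>
  A simple graph is represented by the set of its vertices and the (symmetric, irreflexive)
  set of ordered pairs of adjacent vertices.
\<close>

definition permutability_graph_on ::
    "('a, 'b) monoid_scheme \<Rightarrow> 'a set set \<Rightarrow> 'a set pair_pre_digraph" where
  "permutability_graph_on G V =
     \<lparr>pverts = V,
      parcs = {(H, K). H \<in> V \<and> K \<in> V \<and> H \<noteq> K \<and> H <#>\<^bsub>G\<^esub> K = K <#>\<^bsub>G\<^esub> H}\<rparr>"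

definition permutability_graph :: "('a, 'b) monoid_scheme \<Rightarrow> 'a set pair_pre_digraph" where
  "permutability_graph G =
     permutability_graph_on G {H. subgroup H G \<and> H \<noteq> {\<one>\<^bsub>G\<^esub>} \<and> H \<noteq> carrier G}"

definition nonnormal_permutability_graph ::
    "('a, 'b) monoid_scheme \<Rightarrow> 'a set pair_pre_digraph" where
  "nonnormal_permutability_graph G =
     permutability_graph_on G {H. subgroup H G \<and> H \<noteq> carrier G \<and> \<not> H \<lhd> G}"


section \<open>Complete graphs, disjoint unions and joins\<close>

definition complete_graph :: "nat \<Rightarrow> nat pair_pre_digraph" where
  "complete_graph m =
     \<lparr>pverts = {..<m}, parcs = {(u, v). u < m \<and> v < m \<and> u \<noteq> v}\<rparr>"

definition disjoint_union_graph ::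
    "'a pair_pre_digraph \<Rightarrow> 'b pair_pre_digraph \<Rightarrow> ('a + 'b) pair_pre_digraph" where
  "disjoint_union_graph G1 G2 =
     \<lparr>pverts = pverts G1 <+> pverts G2,
      parcs = map_prod Inl Inl ` parcs G1 \<union> map_prod Inr Inr ` parcs G2\<rparr>"

definition join_graph ::
    "'a pair_pre_digraph \<Rightarrow> 'b pair_pre_digraph \<Rightarrow> ('a + 'b) pair_pre_digraph" where
  "join_graph G1 G2 =
     \<lparr>pverts = pverts G1 <+> pverts G2,
      parcs = parcs (disjoint_union_graph G1 G2)
        \<union> (Inl ` pverts G1) \<times> (Inr ` pverts G2)
        \<union> (Inr ` pverts G2) \<times> (Inl ` pverts G1)\<rparr>"

definition two_K2 :: "(nat + nat) pair_pre_digraph" where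
  "two_K2 = disjoint_union_graph (complete_graph 2) (complete_graph 2)"

text \<open>Since the arcs are symmetric, digraph isomorphism is isomorphism of simple graphs.\<close>

definition graph_iso :: "'a pair_pre_digraph \<Rightarrow> 'b pair_pre_digraph \<Rightarrow> bool" (infix \<open>\<simeq>\<^sub>g\<close> 50) where
  "G1 \<simeq>\<^sub>g G2 \<longleftrightarrow> digraph_iso (with_proj G1) (with_proj G2)"

end

theory Submission
  imports Defs "HOL-Number_Theory.Cong"
begin

text \<open>
  With $q = p^{\alpha-2}$, every element of the modular group is $a^i b^j$ with $i$ unique modulo
  $p^{\alpha-1}$ and $j$ unique modulo $p$, and
  $a^i b^j \cdot a^k b^l = a^{i+k+jkq} b^{j+l}$; uniqueness is seen in a model on pairs of integers.
  A subgroup $H$ meets $\langle a\rangle$ in some $\langle a^{p^s}\rangle$. Either $H$ equals this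
  intersection, or $H = \langle a^{p^s}, a^c b\rangle$ for some $c$. If $p^\alpha \neq 8$, then
  $p^{s-1}$ divides $c$, so for each $s = 1, \dots, \alpha-1$ there are $p$ proper subgroups of
  the second kind. They are normal for $s \le \alpha-2$; the $p$ subgroups with $s = \alpha-1$ are not,
  and they lie in the abelian subgroup $\langle a^q, b\rangle$, so they permute.
  In the group of order 8, $c$ is arbitrary and $\langle a^i b\rangle$, $\langle a^k b\rangle$
  permute iff $i - k$ is even.
\<close>

section \<open>Isomorphisms of permutability graphs\<close>

text \<open>Relations only ever prove words equal. That different normal forms are different needs a
  homomorphism out of the presented group, and this is the whole purpose of the model. Exponents
  stay integers rather than residues, so that questions about subgroups become divisibility
  questions. The only non-linear term of the multiplication law is tamed by \<open>p * q = n\<close>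
  and \<open>n dvd q * q\<close>, where \<open>n\<close> is p^(\<alpha>-1); the second holds because
  \<alpha> \<ge> 3. Commutators are powers of a^q. A subgroup containing a^q is therefore stable
  under conjugation, which is the bound s \<le> \<alpha>-2; at s = \<alpha>-1 the commutator of a
  with a^c b falls outside the subgroup. The restriction on c comes from the p-th power of a^c b,
  which lies in both H and <a>. Normal subgroups permute with every subgroup, so only the few
  non-normal ones have to be compared with each other. The normal vertices number (\<alpha>-1) +
  (\<alpha>-2)p in every case, which is 4 for order 8.\<close>

lemma graph_iso_iff:
  assumes "pair_wf_digraph G1"
  shows "G1 \<simeq>\<^sub>g G2 \<longleftrightarrow>
    (\<exists>f. bij_betw f (pverts G1) (pverts G2) \<and> parcs G2 = map_prod f f ` parcs G1)"
proof
  assume "G1 \<simeq>\<^sub>g G2"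
  then obtain h where h: "pre_digraph.digraph_isomorphism (with_proj G1) h"
    and G2: "with_proj G2 = app_iso h (with_proj G1)"
    unfolding graph_iso_def digraph_iso_def by blast
  have t: "iso_tail h = fst" "iso_head h = snd" 
    and V: "pverts G2 = iso_verts h ` pverts G1" and A: "parcs G2 = iso_arcs h ` parcs G1"
    using G2 by (simp_all add: with_proj_def app_iso_def)
  \<comment> \<open>Tails and heads are the two projections in both graphs, so the vertex map leaves
    no freedom for the arc map.\<close>
  have "iso_arcs h a = map_prod (iso_verts h) (iso_verts h) a" if "a \<in> parcs G1" for a
    using h that unfolding pre_digraph.digraph_isomorphism_def
    by (simp add: t map_prod_def split_beta prod_eq_iff)
  with A have "parcs G2 = map_prod (iso_verts h) (iso_verts h) ` parcs G1"
    by simp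
  moreover have "bij_betw (iso_verts h) (pverts G1) (pverts G2)"
    using h V by (simp add: pre_digraph.digraph_isomorphism_def bij_betw_def)
  ultimately show "\<exists>f. bij_betw f (pverts G1) (pverts G2) \<and> parcs G2 = map_prod f f ` parcs G1"
    by blast
next
  assume "\<exists>f. bij_betw f (pverts G1) (pverts G2) \<and> parcs G2 = map_prod f f ` parcs G1"
  then obtain f where f: "bij_betw f (pverts G1) (pverts G2)"
    and A: "parcs G2 = map_prod f f ` parcs G1" by blast
  interpret pair_wf_digraph G1 by (rule assms)
  let ?h = "\<lparr>iso_verts = f, iso_arcs = map_prod f f, iso_head = snd, iso_tail = fst\<rparr>"
  have "parcs G1 \<subseteq> pverts G1 \<times> pverts G1"
    using in_arcsD1 in_arcsD2 by auto
  then have "inj_on (map_prod f f) (parcs G1)"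
    using f by (auto simp: bij_betw_def intro: inj_on_subset[OF map_prod_inj_on])
  then have "digraph_isomorphism ?h"
    using f by (simp add: digraph_isomorphism_def bij_betw_def wf_digraph_axioms)
  moreover have "with_proj G2 = app_iso ?h (with_proj G1)"
    using f A by (simp add: with_proj_def app_iso_def bij_betw_def)
  ultimately show "G1 \<simeq>\<^sub>g G2"
    unfolding graph_iso_def digraph_iso_def by blast
qed

text \<open>A map out of an explicit standard graph can be written down by cases, whereas a map on
  subgroups would first have to recover a generator.\<close>

lemma graph_isoI_inverse:
  assumes "pair_wf_digraph G1" "pair_wf_digraph G2"
    and f: "bij_betw f (pverts G2) (pverts G1)" and A: "parcs G1 = map_prod f f ` parcs G2"
  shows "G1 \<simeq>\<^sub>g G2"
proof -
  interpret G2: pair_wf_digraph G2 by fact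
  let ?g = "inv_into (pverts G2) f"
  have "map_prod ?g ?g (map_prod f f a) = a" if "a \<in> parcs G2" for a
    using that f G2.in_arcsD1[of "fst a" "snd a"] G2.in_arcsD2[of "fst a" "snd a"]
    by (cases a) (simp add: bij_betw_def)
  then have "parcs G2 = map_prod ?g ?g ` parcs G1"
    by (simp add: A image_image)
  then show ?thesis
    using bij_betw_inv_into[OF f] graph_iso_iff[OF assms(1)] by blast
qed

lemma pair_wf_digraph_permutability_graph_on: "pair_wf_digraph (permutability_graph_on G V)"
  by unfold_locales (auto simp: permutability_graph_on_def)

lemma pair_wf_digraph_complete_graph: "pair_wf_digraph (complete_graph m)"
  by unfold_locales (auto simp: complete_graph_def)

lemma pair_wf_digraph_disjoint_union_graph:
  assumes "pair_wf_digraph G1" "pair_wf_digraph G2"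
  shows "pair_wf_digraph (disjoint_union_graph G1 G2)"
  using assms unfolding pair_wf_digraph_def
  by (auto simp: disjoint_union_graph_def)

lemma permutability_graph_on_complete:
  assumes "finite V" "\<And>H K. H \<in> V \<Longrightarrow> K \<in> V \<Longrightarrow> H <#>\<^bsub>G\<^esub> K = K <#>\<^bsub>G\<^esub> H"
  shows "permutability_graph_on G V \<simeq>\<^sub>g complete_graph (card V)"
proof -
  obtain f where f: "bij_betw f V {..<card V}"
    using ex_bij_betw_finite_nat[OF assms(1)] by (auto simp: atLeast0LessThan)
  have "{(u, v). u < card V \<and> v < card V \<and> u \<noteq> v} =
    map_prod f f ` {(H, K). H \<in> V \<and> K \<in> V \<and> H \<noteq> K}" (is "?L = ?R")
  proof
    show "?L \<subseteq> ?R"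
    proof clarify
      fix u v assume "u < card V" "v < card V" "u \<noteq> v"
      then have "u \<in> f ` V" "v \<in> f ` V" using f by (auto simp: bij_betw_def)
      with \<open>u \<noteq> v\<close> show "(u, v) \<in> ?R" by force
    qed
    show "?R \<subseteq> ?L"
      using f by (auto simp: bij_betw_def inj_on_eq_iff)
  qed
  also have "{(H, K). H \<in> V \<and> K \<in> V \<and> H \<noteq> K} = parcs (permutability_graph_on G V)"
    using assms(2) by (auto simp: permutability_graph_on_def)
  finally show ?thesis
    unfolding graph_iso_iff[OF pair_wf_digraph_permutability_graph_on]
    using f by (auto simp: permutability_graph_on_def complete_graph_def)
qed

lemma map_prod_image_Times: "map_prod f g ` (A \<times> B) = f ` A \<times> g ` B"
  by auto

text \<open>Since \<open>N\<close> permutes with everything, the arcs fall into four blocks: inside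
  \<open>N\<close>, inside \<open>W\<close>, and the two products between them. Isomorphisms on the
  two sides are glued by \<open>Inl\<close> and \<open>Inr\<close>.\<close>

lemma permutability_graph_on_join:
  assumes N: "finite N" "N \<inter> W = {}"
    and perm: "\<And>H K. H \<in> N \<Longrightarrow> K \<in> N \<union> W \<Longrightarrow> H <#>\<^bsub>G\<^esub> K = K <#>\<^bsub>G\<^esub> H"
    and W: "permutability_graph_on G W \<simeq>\<^sub>g G2"
  shows "permutability_graph_on G (N \<union> W) \<simeq>\<^sub>g join_graph (complete_graph (card N)) G2"
proof -
  let ?P = "permutability_graph_on G"
  have "?P N \<simeq>\<^sub>g complete_graph (card N)"
    using N perm by (intro permutability_graph_on_complete) auto
  then obtain f where f: "bij_betw f N (pverts (complete_graph (card N)))"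
    and fA: "parcs (complete_graph (card N)) = map_prod f f ` parcs (?P N)"
    unfolding graph_iso_iff[OF pair_wf_digraph_permutability_graph_on]
    by (auto simp: permutability_graph_on_def)
  obtain g where g: "bij_betw g W (pverts G2)" and gA: "parcs G2 = map_prod g g ` parcs (?P W)"
    using W unfolding graph_iso_iff[OF pair_wf_digraph_permutability_graph_on]
    by (auto simp: permutability_graph_on_def)
  define h where "h H = (if H \<in> N then Inl (f H) else Inr (g H))" for H
  have h: "h H = Inl (f H)" if "H \<in> N" for H using that by (simp add: h_def)
  have h': "h H = Inr (g H)" if "H \<in> W" for H using that N by (auto simp: h_def)
  have "bij_betw h N (Inl ` pverts (complete_graph (card N)))"
    using f by (auto simp: bij_betw_def inj_on_def h image_iff)
  moreover have "bij_betw h W (Inr ` pverts G2)"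
    using g by (auto simp: bij_betw_def inj_on_def h' image_iff)
  ultimately have "bij_betw h (N \<union> W) (pverts (join_graph (complete_graph (card N)) G2))"
    unfolding join_graph_def Plus_def pair_pre_digraph.simps by (rule bij_betw_combine) auto
  moreover have "parcs (join_graph (complete_graph (card N)) G2) =
      map_prod h h ` parcs (?P (N \<union> W))"
  proof -
    have "parcs (?P (N \<union> W)) = parcs (?P N) \<union> parcs (?P W) \<union> N \<times> W \<union> W \<times> N"
      using N(2) perm by (auto simp: permutability_graph_on_def)
    moreover have "map_prod h h ` parcs (?P N) =
        map_prod Inl Inl ` parcs (complete_graph (card N))"
      unfolding fA image_image
      by (rule image_cong) (auto simp: permutability_graph_on_def h)
    moreover have "map_prod h h ` parcs (?P W) = map_prod Inr Inr ` parcs G2"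
      unfolding gA image_image
      by (rule image_cong) (auto simp: permutability_graph_on_def h')
    moreover have "h ` N = Inl ` pverts (complete_graph (card N))" "h ` W = Inr ` pverts G2"
      using f g by (simp_all add: bij_betw_def permutability_graph_on_def h h' image_image[symmetric] cong: image_cong_simp)
    ultimately show ?thesis
      by (simp add: join_graph_def disjoint_union_graph_def image_Un map_prod_image_Times)
  qed
  ultimately show ?thesis
    unfolding graph_iso_iff[OF pair_wf_digraph_permutability_graph_on]
    by (auto simp: permutability_graph_on_def)
qed

section \<open>Normal forms in the modular group\<close>

text \<open>\<open>E i j\<close> stands for $a^i b^j$.\<close>

locale modular_p_group = group G for G (structure) +
  fixes p \<alpha> :: nat and E :: "int \<Rightarrow> int \<Rightarrow> 'a"
  assumes p: "prime p" and \<alpha>: "\<alpha> \<ge> 3"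
    and carrier_eq: "carrier G = (\<Union>i. range (E i))"
    and E_mult: "E i j \<otimes> E k l = E (i + k + j * k * int p ^ (\<alpha> - 2)) (j + l)"
    and E_eq_iff: "E i j = E k l \<longleftrightarrow> int p ^ (\<alpha> - 1) dvd i - k \<and> int p dvd j - l"

text \<open>Multiplication of normal forms on fixed residues: different reduced exponent pairs are
  different elements by construction.\<close>

definition modular_model :: "nat \<Rightarrow> nat \<Rightarrow> (int \<times> int) monoid" where
  "modular_model p \<alpha> =
    \<lparr>carrier = {0..<int p ^ (\<alpha> - 1)} \<times> {0..<int p},
     monoid.mult = (\<lambda>(i, j) (k, l).
       ((i + k + j * k * int p ^ (\<alpha> - 2)) mod int p ^ (\<alpha> - 1), (j + l) mod int p)),
     monoid.one = (0, 0)\<rparr>"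

lemma modular_exponents:
  assumes "\<alpha> \<ge> 3"
  shows "int p * int p ^ (\<alpha> - 2) = int p ^ (\<alpha> - 1)"
    and "int p ^ (\<alpha> - 1) dvd int p ^ (\<alpha> - 2) * int p ^ (\<alpha> - 2)"
    and "int p dvd int p ^ (\<alpha> - 2)"
proof -
  show "int p * int p ^ (\<alpha> - 2) = int p ^ (\<alpha> - 1)"
    using assms by (simp flip: power_Suc add: Suc_diff_Suc numeral_2_eq_2)
  show "int p ^ (\<alpha> - 1) dvd int p ^ (\<alpha> - 2) * int p ^ (\<alpha> - 2)"
    using assms unfolding power_add[symmetric] by (intro le_imp_power_dvd) simp
  show "int p dvd int p ^ (\<alpha> - 2)"
    using assms by simp
qed

lemma group_modular_model:
  assumes "prime p" "\<alpha> \<ge> 3"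
  shows "group (modular_model p \<alpha>)"
proof -
  define q n where "q = int p ^ (\<alpha> - 2)" and "n = int p ^ (\<alpha> - 1)"
  have n: "int p * q = n" "n dvd q * q" "n > 0" "int p > 0"
    using modular_exponents[OF assms(2), of p] prime_gt_0_nat[OF assms(1)]
    by (simp_all add: q_def n_def)
  have carr: "carrier (modular_model p \<alpha>) = {0..<n} \<times> {0..<int p}"
    and mult: "\<And>i j k l. (i, j) \<otimes>\<^bsub>modular_model p \<alpha>\<^esub> (k, l) =
       ((i + k + j * k * q) mod n, (j + l) mod int p)"
    and one: "\<one>\<^bsub>modular_model p \<alpha>\<^esub> = (0, 0)"
    by (simp_all add: modular_model_def q_def n_def)
  show ?thesis
  proof (rule groupI)
    fix x y assume "x \<in> carrier (modular_model p \<alpha>)" "y \<in> carrier (modular_model p \<alpha>)"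
    then show "x \<otimes>\<^bsub>modular_model p \<alpha>\<^esub> y \<in> carrier (modular_model p \<alpha>)"
      using n by (cases x; cases y) (simp add: carr mult)
  next
    fix x y z assume "x \<in> carrier (modular_model p \<alpha>)" "y \<in> carrier (modular_model p \<alpha>)"
      "z \<in> carrier (modular_model p \<alpha>)"
    obtain i j where x: "x = (i, j)" by fastforce
    obtain k l where y: "y = (k, l)" by fastforce
    obtain r s where z: "z = (r, s)" by fastforce
    let ?m = "int p"
    \<comment> \<open>Reducing \<open>j + l\<close> modulo \<open>p\<close> changes the twist by a
      multiple of p * q = n.\<close>
    have "[((i + k + j * k * q) mod n) + r + ((j + l) mod ?m) * r * q
          = (i + k + j * k * q) + r + (j + l) * r * q] (mod n)"
    proof -
      obtain d where d: "(j + l) mod ?m = j + l - ?m * d"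
        by (metis minus_mult_div_eq_mod)
      obtain e where e: "(i + k + j * k * q) mod n = i + k + j * k * q - n * e"
        by (metis minus_mult_div_eq_mod)
      show ?thesis
        unfolding cong_iff_dvd_diff d e
        by (rule dvdI[of _ _ "- e - d * r"]) (simp add: algebra_simps flip: n(1))
    qed
    \<comment> \<open>Expanding the nested twist leaves the extra term
      \<open>j * l * r * (q * q)\<close>, which vanishes modulo \<open>n\<close>.\<close>
    moreover have "[i + ((k + r + l * r * q) mod n) + j * ((k + r + l * r * q) mod n) * q
        = (i + k + j * k * q) + r + (j + l) * r * q] (mod n)"
    proof -
      obtain e where e: "(k + r + l * r * q) mod n = k + r + l * r * q - n * e"
        by (metis minus_mult_div_eq_mod)
      obtain f where f: "q * q = n * f" using n(2) by blast
      have "i + (k + r + l * r * q - n * e) + j * (k + r + l * r * q - n * e) * q -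
        ((i + k + j * k * q) + r + (j + l) * r * q) = - n * e - j * n * e * q + j * l * r * (q * q)"
        by (simp add: algebra_simps)
      also have "\<dots> = n * (- e - j * e * q + j * l * r * f)"
        unfolding f by (simp add: algebra_simps)
      finally show ?thesis
        unfolding cong_iff_dvd_diff e by simp
    qed
    ultimately show "x \<otimes>\<^bsub>modular_model p \<alpha>\<^esub> y \<otimes>\<^bsub>modular_model p \<alpha>\<^esub> z =
        x \<otimes>\<^bsub>modular_model p \<alpha>\<^esub> (y \<otimes>\<^bsub>modular_model p \<alpha>\<^esub> z)"
      unfolding x y z mult by (auto simp: cong_def mod_simps add.assoc)
  next
    fix x assume x: "x \<in> carrier (modular_model p \<alpha>)"
    obtain i j where ij: "x = (i, j)" by fastforce
    \<comment> \<open>The second coordinate of a left inverse must be \<open>- j\<close>; the first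
      then solves i' + i - j * i * q = 0.\<close>
    let ?j = "(- j) mod int p" and ?i = "(- i + j * i * q) mod n"
    obtain d where d: "?j = - j - int p * d"
      by (metis minus_mult_div_eq_mod)
    obtain e where e: "?i = - i + j * i * q - n * e"
      by (metis minus_mult_div_eq_mod)
    have "?i + i + ?j * i * q = n * (- e - d * i)"
      unfolding d e by (simp add: algebra_simps flip: n(1))
    then have "(?i, ?j) \<otimes>\<^bsub>modular_model p \<alpha>\<^esub> x = \<one>\<^bsub>modular_model p \<alpha>\<^esub>"
      unfolding ij mult one by (simp add: mod_simps)
    moreover have "(?i, ?j) \<in> carrier (modular_model p \<alpha>)"
      using n by (simp add: carr)
    ultimately show "\<exists>y\<in>carrier (modular_model p \<alpha>). y \<otimes>\<^bsub>modular_model p \<alpha>\<^esub> x = \<one>\<^bsub>modular_model p \<alpha>\<^esub>"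
      by blast
  qed (use n in \<open>auto simp: carr mult one\<close>)
qed

section \<open>Consequences of the relations, and the homomorphism to the model\<close>

lemma (in group) int_pow_cong:
  assumes "x \<in> carrier G" "x [^] (n::nat) = \<one>" "int n dvd i - j"
  shows "x [^] i = x [^] j"
proof -
  obtain d where "i = j + int n * d"
    using assms(3) by (metis add.commute diff_add_cancel dvdE)
  moreover have "x [^] (int n * d) = \<one>"
    using assms by (simp add: int_pow_pow[symmetric] int_pow_int)
  ultimately show ?thesis
    using assms by (simp add: int_pow_mult)
qed

lemma (in group) conjugate_int_pow:
  assumes "a \<in> carrier G" "b \<in> carrier G"
  shows "(b \<otimes> a \<otimes> inv b) [^] (k::int) = b \<otimes> a [^] k \<otimes> inv b"
proof -
  have "(\<lambda>x. b \<otimes> x \<otimes> inv b) \<in> hom G G"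
    using assms by (auto intro!: homI simp: m_assoc inv_solve_left)
  then interpret group_hom G G "\<lambda>x. b \<otimes> x \<otimes> inv b"
    by unfold_locales
  show ?thesis using hom_int_pow[of a k] assms by simp
qed

text \<open>Conjugation by b multiplies exponents of a by 1 + q, and (1 + jq)(1 + q) agrees with 1 +
  (j+1)q modulo \<open>n\<close> because q^2 vanishes there.\<close>

lemma (in group) modular_commutation:
  assumes ab: "a \<in> carrier G" "b \<in> carrier G"
    and n: "a [^] (n::nat) = \<one>" "int n dvd q * q"
    and rel: "b \<otimes> a \<otimes> inv b = a [^] (1 + q)"
  shows "b [^] (j::nat) \<otimes> a [^] (k::int) = a [^] (k + int j * k * q) \<otimes> b [^] j"
proof (induction j)
  case (Suc j)
  have step: "b \<otimes> a [^] i = a [^] (i + i * q) \<otimes> b" for i :: int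
  proof -
    have "b \<otimes> a [^] i \<otimes> inv b = a [^] (i + i * q)"
      using conjugate_int_pow[OF ab, of i] rel ab
      by (simp add: int_pow_pow algebra_simps)
    then show ?thesis using ab by (metis inv_solve_right int_pow_closed m_closed)
  qed
  have "b [^] Suc j \<otimes> a [^] k = b \<otimes> (b [^] j \<otimes> a [^] k)"
    using ab nat_pow_Suc2[of b j] by (simp add: m_assoc del: nat_pow_Suc)
  also have "\<dots> = b \<otimes> a [^] (k + int j * k * q) \<otimes> b [^] j"
    using ab by (simp add: Suc m_assoc)
  also have "\<dots> = a [^] ((k + int j * k * q) + (k + int j * k * q) * q) \<otimes> (b \<otimes> b [^] j)"
    using ab by (simp add: step m_assoc)
  also have "a [^] ((k + int j * k * q) + (k + int j * k * q) * q) =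
      a [^] (k + int (Suc j) * k * q)"
  proof (rule int_pow_cong[OF ab(1) n(1)])
    have "(k + int j * k * q) + (k + int j * k * q) * q - (k + int (Suc j) * k * q) =
      int j * k * (q * q)" by (simp add: algebra_simps)
    then show "int n dvd (k + int j * k * q) + (k + int j * k * q) * q - (k + int (Suc j) * k * q)"
      using n(2) by simp
  qed
  also have "b \<otimes> b [^] j = b [^] Suc j" using ab nat_pow_Suc2[of b j] by simp
  finally show ?case .
qed (use ab in simp)

lemma word_class_replicate:
  "word_class R (replicate m (x, True)) = word_class R [(x, True)] [^]\<^bsub>presented_group R\<^esub> m"
proof (induction m)
  case (Suc m)
  have "replicate (Suc m) (x, True) = replicate m (x, True) @ [(x, True)]"
    by (simp add: replicate_append_same)
  then show ?case
    by (simp add: Suc nat_pow_def flip: presented_group_simps(3))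
qed (simp add: nat_pow_def)

lemma (in group) eval_word_replicate:
  assumes "f x \<in> carrier G"
  shows "eval_word G f (replicate m (x, True)) = f x [^] m"
proof (induction m)
  case (Suc m)
  then show ?case using nat_pow_Suc2[OF assms, of m] by simp
qed simp

lemma modular_model_pow:
  assumes "prime p" "\<alpha> \<ge> 3"
  shows "(1, 0) [^]\<^bsub>modular_model p \<alpha>\<^esub> (m::nat) = (int m mod int p ^ (\<alpha> - 1), 0)"
    and "(0, 1) [^]\<^bsub>modular_model p \<alpha>\<^esub> (m::nat) = (0, int m mod int p)"
  by (induction m) (simp_all add: nat_pow_def modular_model_def mod_simps add.commute)

lemma modular_model_hom:
  assumes "prime p" "\<alpha> \<ge> 3"
  obtains h where "h \<in> hom (modular_group p \<alpha>) (modular_model p \<alpha>)"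
    "h (word_class (modular_relations p \<alpha>) [(Gen_a, True)]) = (1, 0)"
    "h (word_class (modular_relations p \<alpha>) [(Gen_b, True)]) = (0, 1)"
proof -
  let ?M = "modular_model p \<alpha>"
  interpret M: group ?M by (rule group_modular_model[OF assms])
  define f where "f x = (case x of Gen_a \<Rightarrow> (1::int, 0::int) | Gen_b \<Rightarrow> (0, 1))" for x
  have f_simps [simp]: "f Gen_a = (1, 0)" "f Gen_b = (0, 1)"
    by (simp_all add: f_def)
  have one: "\<one>\<^bsub>?M\<^esub> = (0, 0)" by (simp add: modular_model_def)
  have p: "int p > 1" "int p ^ (\<alpha> - 1) > 1"
    using prime_gt_1_nat[OF assms(1)] assms(2) by (simp_all add: one_less_power)
  have f: "f x \<in> carrier ?M" for x
    using p by (cases x) (auto simp: modular_model_def)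
  have "eval_word ?M f u = eval_word ?M f v" if uv: "(u, v) \<in> modular_relations p \<alpha>" for u v
  proof -
    consider "u = replicate (p ^ (\<alpha> - 1)) (Gen_a, True)" "v = []"
      | "u = replicate p (Gen_b, True)" "v = []"
      | "u = [(Gen_b, True), (Gen_a, True), (Gen_b, False)]"
        "v = replicate (1 + p ^ (\<alpha> - 2)) (Gen_a, True)"
      using uv unfolding modular_relations_def by blast
    then show ?thesis
    proof cases
      case 3
      \<comment> \<open>The conjugation relation is checked in the form ba = a^(1+q) b, which avoids
        computing an inverse in the model.\<close>
      have "(0, 1) \<otimes>\<^bsub>?M\<^esub> (1, 0) =
          (1, 0) [^]\<^bsub>?M\<^esub> (1 + p ^ (\<alpha> - 2)) \<otimes>\<^bsub>?M\<^esub> (0, 1)"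
        unfolding modular_model_pow[OF assms] using p by (simp add: modular_model_def)
      moreover have "eval_word ?M f u = (0, 1) \<otimes>\<^bsub>?M\<^esub> (1, 0) \<otimes>\<^bsub>?M\<^esub> inv\<^bsub>?M\<^esub> (0, 1)"
        using f[of Gen_a] f[of Gen_b] by (simp add: 3 M.m_assoc)
      ultimately show ?thesis
        using f[of Gen_a] f[of Gen_b]
        by (simp add: 3(2) M.eval_word_replicate M.m_assoc del: replicate_Suc)
    qed (use f[of Gen_a] f[of Gen_b] in \<open>simp_all add: M.eval_word_replicate modular_model_pow[OF assms] one\<close>)
  qed
  then obtain h where "h \<in> hom (modular_group p \<alpha>) ?M"
    "\<forall>x. h (word_class (modular_relations p \<alpha>) [(x, True)]) = f x"
    using presented_group_universal[OF M.is_group, of f "modular_relations p \<alpha>"] f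
    unfolding modular_group_def by blast
  then show thesis using that by simp
qed

text \<open>The relations bring every word to the form a^i b^j; the homomorphism to the model reads
  the residues of i and j back off, so they are unique.\<close>

lemma ex_modular_p_group_modular_group:
  assumes "prime p" "\<alpha> \<ge> 3"
  shows "\<exists>E. modular_p_group (modular_group p \<alpha>) p \<alpha> E"
proof -
  define R where "R = modular_relations p \<alpha>"
  have M: "modular_group p \<alpha> = presented_group R"
    by (simp add: modular_group_def R_def)
  interpret G: group "presented_group R" by (rule group_presented_group)
  define a b where "a = word_class R [(Gen_a, True)]" and "b = word_class R [(Gen_b, True)]"
  define q n where "q = int p ^ (\<alpha> - 2)" and "n = int p ^ (\<alpha> - 1)"
  have n: "int p * q = n" "n dvd q * q" "n > 0" "int p > 0"
    using modular_exponents[OF assms(2), of p] prime_gt_0_nat[OF assms(1)]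
    by (simp_all add: q_def n_def)
  have ab [simp]: "a \<in> carrier (presented_group R)" "b \<in> carrier (presented_group R)"
    by (simp_all add: a_def b_def)
  have a_n: "a [^]\<^bsub>presented_group R\<^esub> (p ^ (\<alpha> - 1)) = \<one>\<^bsub>presented_group R\<^esub>"
    and b_p: "b [^]\<^bsub>presented_group R\<^esub> p = \<one>\<^bsub>presented_group R\<^esub>"
    unfolding a_def b_def word_class_replicate[symmetric] presented_group_simps word_class_eq_iff
    by (auto intro!: word_eq.relation simp: R_def modular_relations_def)
  have inv_a: "inv\<^bsub>presented_group R\<^esub> a = word_class R [(Gen_a, False)]"
    and inv_b: "inv\<^bsub>presented_group R\<^esub> b = word_class R [(Gen_b, False)]"
    unfolding a_def b_def
    using word_eq.cancel[of R Gen_a False] word_eq.cancel[of R Gen_b False]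
    by - (rule G.inv_equality; auto simp: word_class_eq_iff)+
  have "b \<otimes>\<^bsub>presented_group R\<^esub> a \<otimes>\<^bsub>presented_group R\<^esub> inv\<^bsub>presented_group R\<^esub> b =
      word_class R [(Gen_b, True), (Gen_a, True), (Gen_b, False)]"
    unfolding inv_b unfolding a_def b_def by simp
  also have "\<dots> = word_class R (replicate (1 + p ^ (\<alpha> - 2)) (Gen_a, True))"
    unfolding word_class_eq_iff
    by (rule word_eq.relation) (simp add: R_def modular_relations_def)
  also have "\<dots> = a [^]\<^bsub>presented_group R\<^esub> (1 + q)"
    unfolding word_class_replicate a_def[symmetric] int_pow_int[symmetric] by (simp add: q_def)
  finally have rel: "b \<otimes>\<^bsub>presented_group R\<^esub> a \<otimes>\<^bsub>presented_group R\<^esub> inv\<^bsub>presented_group R\<^esub> b =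
      a [^]\<^bsub>presented_group R\<^esub> (1 + q)" .
  have a_cong: "a [^]\<^bsub>presented_group R\<^esub> i = a [^]\<^bsub>presented_group R\<^esub> j" if "n dvd i - j" for i j :: int
    using that by (intro G.int_pow_cong[OF ab(1) a_n]) (simp add: n_def)
  have b_cong: "b [^]\<^bsub>presented_group R\<^esub> i = b [^]\<^bsub>presented_group R\<^esub> j" if "int p dvd i - j" for i j :: int
    using that by (intro G.int_pow_cong[OF ab(2) b_p])
  have commute: "b [^]\<^bsub>presented_group R\<^esub> j \<otimes>\<^bsub>presented_group R\<^esub> a [^]\<^bsub>presented_group R\<^esub> k =
      a [^]\<^bsub>presented_group R\<^esub> (k + j * k * q) \<otimes>\<^bsub>presented_group R\<^esub> b [^]\<^bsub>presented_group R\<^esub> j" for j k :: int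
  proof -
    \<comment> \<open>The commutation rule is known for natural exponents of b. As b^p = 1,
      \<open>j\<close> may be replaced by its residue, which changes \<open>j * k * q\<close> by a
      multiple of p * q = n.\<close>
    define m where "m = nat (j mod int p)"
    obtain d where d: "j - int m = int p * d"
      using n(4) by (metis m_def int_nat_eq minus_mod_eq_mult_div pos_mod_sign)
    have "b [^]\<^bsub>presented_group R\<^esub> j = b [^]\<^bsub>presented_group R\<^esub> m"
      unfolding int_pow_int[symmetric] by (rule b_cong) (simp add: d)
    moreover
    have "n dvd (k + int m * k * q) - (k + j * k * q)"
    proof -
      have "(k + int m * k * q) - (k + j * k * q) = - (j - int m) * k * q"
        by (simp add: algebra_simps)
      also have "\<dots> = n * - (d * k)"
        unfolding d n(1)[symmetric] by (simp add: algebra_simps)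
      finally show ?thesis by simp
    qed
    from a_cong[OF this] calculation show ?thesis
      using G.modular_commutation[OF ab a_n _ rel, of m k] n(2) by (simp add: n_def)
  qed
  define E where "E i j = a [^]\<^bsub>presented_group R\<^esub> i \<otimes>\<^bsub>presented_group R\<^esub> b [^]\<^bsub>presented_group R\<^esub> j"
    for i j :: int
  have E_carrier [simp]: "E i j \<in> carrier (presented_group R)" for i j
    unfolding E_def by (intro G.m_closed G.int_pow_closed ab)
  have E_mult: "E i j \<otimes>\<^bsub>presented_group R\<^esub> E k l = E (i + k + j * k * q) (j + l)" for i j k l
  proof -
    have "E i j \<otimes>\<^bsub>presented_group R\<^esub> E k l = a [^]\<^bsub>presented_group R\<^esub> i \<otimes>\<^bsub>presented_group R\<^esub>
        (b [^]\<^bsub>presented_group R\<^esub> j \<otimes>\<^bsub>presented_group R\<^esub> a [^]\<^bsub>presented_group R\<^esub> k) \<otimes>\<^bsub>presented_group R\<^esub>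
        b [^]\<^bsub>presented_group R\<^esub> l"
      unfolding E_def by (simp only: G.m_assoc G.m_closed G.int_pow_closed ab)
    also have "\<dots> = E (i + (k + j * k * q)) (j + l)"
      unfolding E_def commute
      by (simp only: G.m_assoc G.m_closed G.int_pow_closed G.int_pow_mult ab)
    finally show ?thesis by (simp add: add.assoc)
  qed
  have letter: "word_class R [l] \<in> (\<Union>i. range (E i))" for l
  proof -
    have "E 1 0 = a" "E 0 1 = b" "E (-1) 0 = inv\<^bsub>presented_group R\<^esub> a" "E 0 (-1) = inv\<^bsub>presented_group R\<^esub> b"
      using ab by (simp_all add: E_def G.int_pow_neg del: presented_group_simps)
    then have letter: "word_class R [(x, s)] \<in> {E 1 0, E 0 1, E (-1) 0, E 0 (-1)}" for x s
      by (cases x; cases s) (simp_all add: inv_a inv_b, simp_all add: a_def b_def)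
    have "E i j \<in> (\<Union>i. range (E i))" for i j by blast
    then have sub: "{E 1 0, E 0 1, E (-1) 0, E 0 (-1)} \<subseteq> (\<Union>i. range (E i))"
      by (simp only: insert_subset empty_subsetI simp_thms)
    obtain x s where l: "l = (x, s)" by fastforce
    show ?thesis unfolding l by (rule subsetD[OF sub letter])
  qed
  \<comment> \<open>Each further letter is absorbed by the multiplication law.\<close>
  have word: "word_class R u \<in> (\<Union>i. range (E i))" for u
  proof (induction u)
    case Nil
    have "word_class R [] = E 0 0" by (simp add: E_def)
    then show ?case by blast
  next
    case (Cons l u)
    obtain i j k m where "word_class R [l] = E i j" "word_class R u = E k m"
      using letter[of l] Cons by blast
    then have "word_class R (l # u) = E (i + k + j * k * q) (j + m)"
      using presented_group_simps(3)[of R "[l]" u] E_mult by simp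
    then show ?case by blast
  qed
  obtain h where h: "h \<in> hom (presented_group R) (modular_model p \<alpha>)"
    and hab: "h a = (1, 0)" "h b = (0, 1)"
    using modular_model_hom[OF assms] unfolding M a_def b_def R_def[symmetric] by metis
  interpret h: group_hom "presented_group R" "modular_model p \<alpha>" h
    using h group_modular_model[OF assms] G.group_axioms
    by (simp add: group_hom_def group_hom_axioms_def)
  have hE: "h (E i j) = (i mod n, j mod int p)" for i j
  proof -
    \<comment> \<open>Powers in the model are computed for natural exponents, so both exponents are
      first reduced.\<close>
    have "a [^]\<^bsub>presented_group R\<^esub> i = a [^]\<^bsub>presented_group R\<^esub> nat (i mod n)"
      unfolding int_pow_int[symmetric] using n(3) by (intro a_cong) (simp add: minus_mod_eq_mult_div)
    moreover have "b [^]\<^bsub>presented_group R\<^esub> j = b [^]\<^bsub>presented_group R\<^esub> nat (j mod int p)"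
      unfolding int_pow_int[symmetric] using n(4) by (intro b_cong) (simp add: minus_mod_eq_mult_div)
    ultimately have "h (E i j) = (1, 0) [^]\<^bsub>modular_model p \<alpha>\<^esub> nat (i mod n)
        \<otimes>\<^bsub>modular_model p \<alpha>\<^esub> (0, 1) [^]\<^bsub>modular_model p \<alpha>\<^esub> nat (j mod int p)"
      unfolding E_def by (simp only: h.hom_mult h.hom_nat_pow G.nat_pow_closed ab hab)
    also have "\<dots> = (i mod n, j mod int p)"
      unfolding modular_model_pow[OF assms] using n(3,4)
      by (simp add: modular_model_def n_def)
    finally show ?thesis .
  qed
  have E_eq: "E i j = E k l \<longleftrightarrow> n dvd i - k \<and> int p dvd j - l" for i j k l
  proof
    assume "E i j = E k l"
    then have "(i mod n, j mod int p) = (k mod n, l mod int p)"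
      using hE by metis
    then show "n dvd i - k \<and> int p dvd j - l"
      by (simp add: mod_eq_dvd_iff)
  next
    assume "n dvd i - k \<and> int p dvd j - l"
    then show "E i j = E k l" unfolding E_def using a_cong[of i k] b_cong[of j l] by simp
  qed
  have "modular_p_group (presented_group R) p \<alpha> E"
  proof unfold_locales
    show "carrier (presented_group R) = (\<Union>i. range (E i))"
      using word E_carrier by auto
  qed (use assms E_mult E_eq in \<open>simp_all add: q_def n_def del: presented_group_simps\<close>)
  then show ?thesis unfolding M by blast
qed

section \<open>Subgroups of the modular group\<close>

lemma int_subgroup_mult:
  fixes S :: "int set"
  assumes "\<And>a b. a \<in> S \<Longrightarrow> b \<in> S \<Longrightarrow> a - b \<in> S" and "a \<in> S"
  shows "k * a \<in> S"
proof (induction k rule: int_induct[of _ 0])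
  case base
  show ?case using assms(1)[OF assms(2) assms(2)] by simp
next
  case (step1 i)
  have "- a \<in> S"
    using assms(1)[OF assms(1)[OF assms(2) assms(2)] assms(2)] by simp
  from assms(1)[OF step1(2) this] show ?case by (simp add: algebra_simps)
next
  case (step2 i)
  from assms(1)[OF step2(2) assms(2)] show ?case by (simp add: algebra_simps)
qed

lemma int_subgroup_gcd:
  fixes S :: "int set"
  assumes "\<And>a b. a \<in> S \<Longrightarrow> b \<in> S \<Longrightarrow> a - b \<in> S" and "a \<in> S" "b \<in> S"
  shows "gcd a b \<in> S"
proof -
  obtain u v where "u * a + v * b = gcd a b" using bezout_int by blast
  moreover have "u * a - (- v) * b \<in> S"
    using assms int_subgroup_mult[of S] by blast
  ultimately show ?thesis by simp
qed

text \<open>The least power p^s in \<open>S\<close> generates it: for x in \<open>S\<close>, the gcd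
  of x and p^s lies in \<open>S\<close> by Bezout and is again a power of p, so minimality makes it
  p^s.\<close>

lemma int_subgroup_prime_power:
  fixes S :: "int set"
  assumes diff: "\<And>a b. a \<in> S \<Longrightarrow> b \<in> S \<Longrightarrow> a - b \<in> S"
    and p: "prime p" and S: "int p ^ m \<in> S"
  obtains s where "s \<le> m" "\<And>x. x \<in> S \<longleftrightarrow> int p ^ s dvd x"
proof -
  define s where "s = (LEAST s. int p ^ s \<in> S)"
  have s: "int p ^ s \<in> S" "s \<le> m"
    using S unfolding s_def by (fact LeastI, fact Least_le)
  have "x \<in> S \<longleftrightarrow> int p ^ s dvd x" for x
  proof
    assume "x \<in> S"
    then have g: "gcd x (int p ^ s) \<in> S"
      using int_subgroup_gcd diff s by blast
    have "prime (int p)" using p by simp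
    then obtain r where r: "r \<le> s" "normalize (gcd x (int p ^ s)) = int p ^ r"
      using divides_primepow[of "int p" "gcd x (int p ^ s)" s] by auto
    then have "gcd x (int p ^ s) = int p ^ r" by simp
    with g have "s \<le> r" unfolding s_def by (auto intro: Least_le)
    with r \<open>gcd x (int p ^ s) = int p ^ r\<close> show "int p ^ s dvd x"
      by (metis gcd_dvd1 le_antisym)
  next
    assume "int p ^ s dvd x"
    then show "x \<in> S"
      using int_subgroup_mult[of S] diff s by (metis dvdE mult.commute)
  qed
  with s that show thesis by blast
qed

section \<open>Two families of subgroups and their normality\<close>

context modular_p_group
begin

text \<open>
  \<open>A s\<close> is $\langle a^{p^s}\rangle$, and \<open>B s c\<close> is $\langle a^{p^s}, a^c b\rangle$ provided that
  \<open>p ^ s dvd p * c\<close>; without this condition it need not be a subgroup.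
\<close>

definition A :: "nat \<Rightarrow> 'a set" where
  "A s = {E x j |x j. int p ^ s dvd x \<and> int p dvd j}"

definition B :: "nat \<Rightarrow> int \<Rightarrow> 'a set" where
  "B s c = {E x j |x j. int p ^ s dvd x - c * j}"

abbreviation q :: int where "q \<equiv> int p ^ (\<alpha> - 2)"
abbreviation n :: int where "n \<equiv> int p ^ (\<alpha> - 1)"

lemma prime_int_p: "prime (int p)" using p by simp

lemma p_pos: "int p > 1" using prime_gt_1_nat[OF p] by simp

lemma pq: "int p * q = n" and n_dvd: "n dvd q * q" and p_dvd_q: "int p dvd q"
  using modular_exponents[OF \<alpha>] by auto

lemma power_dvd_n: "s \<le> \<alpha> - 1 \<Longrightarrow> int p ^ s dvd n"
  and power_dvd_q: "s \<le> \<alpha> - 2 \<Longrightarrow> int p ^ s dvd q"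
  by (simp_all add: le_imp_power_dvd)

lemma E_closed [simp]: "E i j \<in> carrier G"
  using carrier_eq by blast

lemma carrierE:
  assumes "g \<in> carrier G"
  obtains i j where "g = E i j"
  using assms carrier_eq by blast

lemma subgroup_eqI_E:
  assumes H: "subgroup H G" and K: "subgroup K G" and HK: "\<And>x j. E x j \<in> H \<longleftrightarrow> E x j \<in> K"
  shows "H = K"
proof (rule Set.set_eqI)
  fix g
  show "g \<in> H \<longleftrightarrow> g \<in> K"
  proof (cases "g \<in> carrier G")
    case True
    then show ?thesis using HK by (elim carrierE) simp
  next
    case False
    then show ?thesis using subgroup.mem_carrier[OF H] subgroup.mem_carrier[OF K] by blast
  qed
qed

lemma one_eq: "\<one> = E 0 0"
  using E_mult[of 0 0 0 0] by (simp add: r_cancel_one')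

lemma inv_E: "inv (E i j) = E (- i + j * i * q) (- j)"
  by (rule inv_equality) (simp_all add: E_mult one_eq algebra_simps)

text \<open>The b-exponent is untouched and the a-exponent moves by a multiple of \<open>q\<close>;
  the normality of \<open>A s\<close> and \<open>B s c\<close> is read off this shift.\<close>

lemma E_conjugate: "E k l \<otimes> E x j \<otimes> inv (E k l) = E (x + (l * x - j * k) * q) j"
proof -
  have "E k l \<otimes> E x j = E (x + (l * x - j * k) * q) j \<otimes> E k l"
    by (simp add: E_mult algebra_simps)
  then show ?thesis by (simp add: m_assoc)
qed

lemma E_in_A_iff: "s \<le> \<alpha> - 1 \<Longrightarrow> E x j \<in> A s \<longleftrightarrow> int p ^ s dvd x \<and> int p dvd j"
proof
  assume s: "s \<le> \<alpha> - 1" and "E x j \<in> A s"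
  then obtain y k where "E x j = E y k" and y: "int p ^ s dvd y" "int p dvd k"
    unfolding A_def by blast
  then have "n dvd x - y" "int p dvd j - k" by (auto simp: E_eq_iff)
  then have "int p ^ s dvd x - y" using power_dvd_n[OF s] by (blast intro: dvd_trans)
  from dvd_add[OF this y(1)] dvd_add[OF \<open>int p dvd j - k\<close> y(2)]
  show "int p ^ s dvd x \<and> int p dvd j" by simp
qed (auto simp: A_def)

text \<open>The exponent j is determined only modulo \<open>p\<close>, so the criterion must survive
  replacing j by j + p; this is what the condition on \<open>c\<close> guarantees.\<close>

lemma E_in_B_iff:
  assumes s: "s \<le> \<alpha> - 1" and c: "int p ^ s dvd int p * c"
  shows "E x j \<in> B s c \<longleftrightarrow> int p ^ s dvd x - c * j"
proof
  assume "E x j \<in> B s c"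
  then obtain y k where "E x j = E y k" and y: "int p ^ s dvd y - c * k"
    unfolding B_def by blast
  then have xy: "n dvd x - y" and "int p dvd j - k" by (auto simp: E_eq_iff)
  from this(2) have "int p * c dvd (j - k) * c" by (rule mult_dvd_mono) simp
  with c have "int p ^ s dvd (j - k) * c" by (rule dvd_trans)
  moreover have "int p ^ s dvd x - y" using xy power_dvd_n[OF s] dvd_trans by blast
  ultimately have "int p ^ s dvd (x - y) + (y - c * k) - (j - k) * c"
    by (intro dvd_diff[OF dvd_add[OF _ y]])
  then show "int p ^ s dvd x - c * j" by (simp add: algebra_simps)
qed (auto simp: B_def)

lemma subgroup_A:
  assumes s: "s \<le> \<alpha> - 1"
  shows "subgroup (A s) G"
proof (rule subgroupI)
  show "A s \<subseteq> carrier G" "A s \<noteq> {}" by (auto simp: A_def)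
  fix g assume "g \<in> A s"
  then obtain x j where g: "g = E x j" "int p ^ s dvd x" "int p dvd j" by (auto simp: A_def)
  then show "inv g \<in> A s"
    by (simp add: inv_E E_in_A_iff[OF s] dvd_diff)
  fix h assume "h \<in> A s"
  then obtain y k where h: "h = E y k" "int p ^ s dvd y" "int p dvd k" by (auto simp: A_def)
  then show "g \<otimes> h \<in> A s"
    using g by (simp add: E_mult E_in_A_iff[OF s])
qed

text \<open>If x = cj modulo p^s then px = 0 modulo p^s, and p divides q. Hence the twist is
  invisible modulo p^s on \<open>B s c\<close>, where x - cj behaves additively.\<close>

lemma power_dvd_mult_q:
  assumes c: "int p ^ s dvd int p * c" and x: "int p ^ s dvd x - c * j"
  shows "int p ^ s dvd x * q"
proof -
  have "int p ^ s dvd int p * (x - c * j) + int p * c * j"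
    using c x by (intro dvd_add) auto
  also have "int p * (x - c * j) + int p * c * j = x * int p" by (simp add: algebra_simps)
  also have "\<dots> dvd x * q" using p_dvd_q by simp
  finally show ?thesis .
qed

lemma subgroup_B:
  assumes s: "s \<le> \<alpha> - 1" and c: "int p ^ s dvd int p * c"
  shows "subgroup (B s c) G"
proof (rule subgroupI)
  have "E 0 0 \<in> B s c" by (simp add: E_in_B_iff[OF s c])
  then show "B s c \<subseteq> carrier G" "B s c \<noteq> {}" by (auto simp: B_def)
  fix g assume "g \<in> B s c"
  then obtain x j where g: "g = E x j" "int p ^ s dvd x - c * j" by (auto simp: B_def)
  have "int p ^ s dvd x * q * j - (x - c * j)"
    by (intro dvd_diff[OF dvd_mult2[OF power_dvd_mult_q[OF c g(2)]] g(2)])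
  then show "inv g \<in> B s c"
    by (simp add: g inv_E E_in_B_iff[OF s c] algebra_simps)
  fix h assume "h \<in> B s c"
  then obtain y k where h: "h = E y k" "int p ^ s dvd y - c * k" by (auto simp: B_def)
  have "int p ^ s dvd (x - c * j) + (y - c * k) + y * q * j"
    by (intro dvd_add[OF dvd_add[OF g(2) h(2)] dvd_mult2[OF power_dvd_mult_q[OF c h(2)]]])
  then show "g \<otimes> h \<in> B s c"
    by (simp add: g h E_mult E_in_B_iff[OF s c] algebra_simps)
qed

lemma normal_A:
  assumes s: "s \<le> \<alpha> - 1"
  shows "A s \<lhd> G"
  unfolding normal_inv_iff
proof (intro conjI ballI subgroup_A s)
  fix g h assume "g \<in> carrier G" "h \<in> A s"
  then obtain k l x j where gh: "g = E k l" "h = E x j"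
    and x: "int p ^ s dvd x" "int p dvd j"
    by (auto simp: A_def elim: carrierE)
  \<comment> \<open>\<open>j\<close> supplies the factor p that turns q into n.\<close>
  have "n dvd j * k * q"
    unfolding pq[symmetric] by (rule mult_dvd_mono) (simp_all add: x(2))
  with power_dvd_n[OF s] have "int p ^ s dvd j * k * q" by (rule dvd_trans)
  moreover have "int p ^ s dvd x + x * l * q" by (simp add: x(1))
  ultimately have "int p ^ s dvd x + x * l * q - j * k * q" by (rule dvd_diff[rotated])
  then have "E (x + (l * x - j * k) * q) j \<in> A s"
    using x(2) unfolding E_in_A_iff[OF s] by (simp add: algebra_simps)
  then show "g \<otimes> h \<otimes> inv g \<in> A s"
    by (simp add: gh E_conjugate)
qed

lemma normal_B:
  assumes s: "s \<le> \<alpha> - 2" and c: "int p ^ s dvd int p * c"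
  shows "B s c \<lhd> G"
  unfolding normal_inv_iff
proof (intro conjI ballI subgroup_B c)
  show s': "s \<le> \<alpha> - 1" using s by simp
  fix g h assume "g \<in> carrier G" "h \<in> B s c"
  then obtain k l x j where gh: "g = E k l" "h = E x j"
    and x: "int p ^ s dvd x - c * j"
    by (auto simp: B_def elim: carrierE)
  have "int p ^ s dvd x - c * j + (l * x - j * k) * q"
    by (rule dvd_add[OF x dvd_mult[OF power_dvd_q[OF s]]])
  then have "E (x + (l * x - j * k) * q) j \<in> B s c"
    by (simp add: E_in_B_iff[OF s' c] algebra_simps)
  then show "g \<otimes> h \<otimes> inv g \<in> B s c"
    by (simp add: gh E_conjugate)
qed

text \<open>A normal \<open>H\<close> would contain the commutator of a with a^c b, which is a^(-q)
  since q^2 vanishes modulo \<open>n\<close>; but \<open>n\<close> does not divide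
  \<open>q\<close>.\<close>

lemma not_normal_if_trivial_on_a:
  assumes "E c 1 \<in> H" and "\<And>x. E x 0 \<in> H \<Longrightarrow> n dvd x"
  shows "\<not> H \<lhd> G"
proof
  assume N: "H \<lhd> G"
  then have "E 1 0 \<otimes> E c 1 \<otimes> inv (E 1 0) \<in> H"
    using assms(1) by (auto simp: normal_inv_iff)
  then have "E (c - q) 1 \<in> H" by (simp add: inv_E E_mult algebra_simps)
  moreover have "inv (E c 1) \<in> H"
    using N assms(1) by (meson normal_imp_subgroup subgroup.m_inv_closed)
  ultimately have "E (c - q) 1 \<otimes> inv (E c 1) \<in> H"
    using N by (meson normal_imp_subgroup subgroup.m_closed)
  also have "E (c - q) 1 \<otimes> inv (E c 1) = E (- q + c * q * q) 0"
    by (simp add: inv_E E_mult algebra_simps)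
  finally have "n dvd - q + c * q * q" by (rule assms(2))
  moreover have "n dvd c * q * q" using dvd_mult[OF n_dvd, of c] by (simp add: mult.assoc)
  ultimately have "n dvd - q" by (simp only: dvd_add_left_iff)
  then have "n dvd q" by simp
  then show False
    using p_pos \<alpha> by (simp add: dvd_power_iff)
qed

section \<open>Classification of the subgroups\<close>

lemma subgroup_cases:
  assumes H: "subgroup H G"
  obtains (A) s where "s \<le> \<alpha> - 1" "H = A s"
  | (twisted) s c where "s \<le> \<alpha> - 1" "E c 1 \<in> H" "\<And>x. E x 0 \<in> H \<longleftrightarrow> int p ^ s dvd x"
proof -
  have "E n 0 = \<one>" by (simp add: one_eq E_eq_iff)
  then have n: "int p ^ (\<alpha> - 1) \<in> {x. E x 0 \<in> H}"
    using subgroup.one_closed[OF H] by simp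
  have "E x 0 \<otimes> inv (E y 0) = E (x - y) 0" for x y
    by (simp add: inv_E E_mult)
  then have "x - y \<in> {x. E x 0 \<in> H}" if "x \<in> {x. E x 0 \<in> H}" "y \<in> {x. E x 0 \<in> H}" for x y
    using that subgroup.m_closed[OF H, of "E x 0" "inv (E y 0)"] subgroup.m_inv_closed[OF H, of "E y 0"]
    by simp
  from int_subgroup_prime_power[OF this p n]
  obtain s where s: "s \<le> \<alpha> - 1" "\<And>x. E x 0 \<in> H \<longleftrightarrow> int p ^ s dvd x" by auto
  \<comment> \<open>The b-exponents occurring in \<open>H\<close> form a subgroup of the integers
    containing the prime p. Either all are multiples of p, and then \<open>H\<close> lies in <a>, or
    1 occurs.\<close>
  define J where "J = {j. \<exists>x. E x j \<in> H}"
  have J: "i - j \<in> J" if ij: "i \<in> J" "j \<in> J" for i j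
  proof -
    obtain x y where "E x i \<in> H" "E y j \<in> H" using ij unfolding J_def by blast
    then have "E x i \<otimes> inv (E y j) \<in> H"
      using subgroup.m_closed[OF H] subgroup.m_inv_closed[OF H] by blast
    then show ?thesis unfolding J_def inv_E E_mult by (auto simp: mem_Collect_eq)
  qed
  have pJ: "int p \<in> J"
  proof -
    have "E 0 (int p) = \<one>" by (simp add: one_eq E_eq_iff)
    then have "E 0 (int p) \<in> H" using subgroup.one_closed[OF H] by simp
    then show ?thesis unfolding J_def by blast
  qed
  show thesis
  proof (cases "\<forall>j\<in>J. int p dvd j")
    case True
    have "E x j \<in> H \<longleftrightarrow> E x j \<in> A s" for x j
    proof (cases "int p dvd j")
      case True
      then have "E x j = E x 0" by (simp add: E_eq_iff)
      then show ?thesis using s(2) True by (simp add: E_in_A_iff[OF s(1)])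
    next
      case False
      then have "j \<notin> J" using \<open>\<forall>j\<in>J. int p dvd j\<close> by blast
      with False show ?thesis by (simp add: J_def E_in_A_iff[OF s(1)])
    qed
    then have "H = A s"
      by (rule subgroup_eqI_E[OF H subgroup_A[OF s(1)]])
    then show thesis by (rule A[OF s(1)])
  next
    case False
    then obtain j where j: "j \<in> J" "\<not> int p dvd j" by blast
    then have "gcd (int p) j = 1"
      using prime_imp_coprime[OF prime_int_p] by simp
    then have "1 \<in> J" using int_subgroup_gcd[OF J pJ j(1)] by simp
    then obtain c where "E c 1 \<in> H" unfolding J_def by blast
    then show thesis by (rule twisted[OF s(1) _ s(2)])
  qed
qed

text \<open>The binomial coefficient is 0 + 1 + ... + (m-1), the sum of the twists collected when
  b^i passes a^c.\<close>

lemma E_pow: "E c 1 [^] m = E (int m * c + c * q * int (m choose 2)) (int m)"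
proof (induction m)
  case (Suc m)
  have "Suc m choose 2 = m + (m choose 2)"
    by (simp add: numeral_2_eq_2)
  then show ?case by (simp add: Suc E_mult algebra_simps)
qed (simp add: one_eq numeral_2_eq_2)

text \<open>Elements of \<open>H\<close> with the same b-exponent form one coset of the intersection
  of \<open>H\<close> with <a>.\<close>

lemma mem_subgroup_iff:
  assumes H: "subgroup H G" and "E y j \<in> H" and S: "\<And>x. E x 0 \<in> H \<longleftrightarrow> int p ^ s dvd x"
  shows "E x j \<in> H \<longleftrightarrow> int p ^ s dvd x - y"
proof -
  have "E (x - y) 0 \<otimes> E y j = E x j" by (simp add: E_mult)
  moreover from this have "E (x - y) 0 = E x j \<otimes> inv (E y j)"
    by (simp add: inv_solve_right)
  ultimately have "E x j \<in> H \<longleftrightarrow> E (x - y) 0 \<in> H"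
    using subgroup.m_closed[OF H _ assms(2)]
      subgroup.m_closed[OF H _ subgroup.m_inv_closed[OF H assms(2)]] by metis
  then show ?thesis by (simp add: S)
qed

text \<open>Powers of a^c b give one element of \<open>H\<close> over each b-exponent j. Its
  a-exponent is cj modulo p^s, because p^s divides both cq and pc; the coset description does the
  rest.\<close>

lemma twisted_subgroup_eq_B:
  assumes H: "subgroup H G" and s: "s \<le> \<alpha> - 1" and c: "E c 1 \<in> H"
    and S: "\<And>x. E x 0 \<in> H \<longleftrightarrow> int p ^ s dvd x" and pc: "int p ^ s dvd int p * c"
  shows "H = B s c"
proof -
  have "E x j \<in> H \<longleftrightarrow> E x j \<in> B s c" for x j
  proof -
    define m where "m = nat (j mod int p)"
    obtain d where d: "j - int m = int p * d"
    proof
      show "j - int m = int p * (j div int p)"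
        using p_pos by (simp add: m_def minus_mod_eq_mult_div)
    qed
    have "int p * c dvd q * c" using p_dvd_q by (rule mult_dvd_mono) simp
    with pc have "int p ^ s dvd q * c" by (rule dvd_trans)
    then have "int p ^ s dvd c * q" by (simp add: mult.commute)
    then have 1: "int p ^ s dvd c * q * int (m choose 2)" by simp
    have "E c 1 [^] m \<in> H"
      by (induction m) (simp_all add: subgroup.one_closed[OF H] subgroup.m_closed[OF H] c)
    then have "E (int m * c + c * q * int (m choose 2)) (int m) \<in> H"
      by (simp add: E_pow)
    also have "E (int m * c + c * q * int (m choose 2)) (int m) =
        E (int m * c + c * q * int (m choose 2)) j"
      using d by (simp add: E_eq_iff dvd_diff_commute[of _ _ j])
    finally have "E x j \<in> H \<longleftrightarrow> int p ^ s dvd x - (int m * c + c * q * int (m choose 2))"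
      by (rule mem_subgroup_iff[OF H _ S])
    also have "\<dots> \<longleftrightarrow> int p ^ s dvd x - c * j + (c * (j - int m) - c * q * int (m choose 2))"
      by (simp add: algebra_simps)
    also have "\<dots> \<longleftrightarrow> int p ^ s dvd x - c * j"
    proof (rule dvd_add_left_iff)
      have "int p ^ s dvd int p * c * d" using pc by simp
      then have "int p ^ s dvd c * (j - int m)" by (simp add: d algebra_simps)
      with 1 show "int p ^ s dvd c * (j - int m) - c * q * int (m choose 2)"
        by (rule dvd_diff[rotated])
    qed
    finally show ?thesis by (simp add: E_in_B_iff[OF s pc])
  qed
  then show ?thesis
    by (rule subgroup_eqI_E[OF H subgroup_B[OF s pc]])
qed

section \<open>Parameters, distinctness and number of the subgroups\<close>

definition BB :: "nat \<times> nat \<Rightarrow> 'a set" where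
  "BB = (\<lambda>(s, t). B s (int t * int p ^ (s - 1)))"

text \<open>The index ranges stop where they must: \<open>A (\<alpha> - 1)\<close> is trivial, s = 0
  in the second family gives the whole group, and s = \<alpha>-1 gives non-normal subgroups.\<close>

definition normals :: "'a set set" where
  "normals = A ` {..\<alpha> - 2} \<union> BB ` ({1..\<alpha> - 2} \<times> {..<p})"

text \<open>
  The only place where the group of order 8 is excluded: $(a^c b)^p = a^{cp(1 + pr)}$ holds because
  $p^2$ divides $q \binom{p}{2}$, which fails exactly for $p = 2$, $q = 2$.
\<close>

lemma twisted_condition:
  assumes not8: "p ^ \<alpha> \<noteq> 8" and H: "subgroup H G" and c: "E c 1 \<in> H"
    and S: "\<And>x. E x 0 \<in> H \<longleftrightarrow> int p ^ s dvd x"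
  shows "int p ^ s dvd int p * c"
proof -
  \<comment> \<open>For p = 2 the hypothesis leaves \<alpha> \<ge> 4, so 4 divides q; for odd p, q
    and the binomial coefficient contribute one factor each.\<close>
  have "int p * int p dvd q * int (p choose 2)"
  proof (cases "p = 2")
    case True
    with not8 \<alpha> have "\<alpha> \<noteq> 3" by auto
    with \<alpha> have "int p ^ 2 dvd q" by (intro le_imp_power_dvd) simp
    then show ?thesis by (simp add: power2_eq_square)
  next
    case False
    then have "2 < p" using prime_ge_2_nat[OF p] by simp
    then have "p dvd (p choose 2)" using p by (intro dvd_choose_prime) auto
    then have "int p dvd int (p choose 2)" by simp
    with p_dvd_q show ?thesis by (rule mult_dvd_mono)
  qed
  then obtain r where r: "q * int (p choose 2) = int p * int p * r" by blast
  have "E c 1 [^] m \<in> H" for m :: nat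
    by (induction m) (simp_all add: subgroup.one_closed[OF H] subgroup.m_closed[OF H] c)
  from this[of p] have "E (int p * c + c * q * int (p choose 2)) (int p) \<in> H"
    by (simp only: E_pow)
  also have "E (int p * c + c * q * int (p choose 2)) (int p) =
      E (int p * c + c * q * int (p choose 2)) 0"
    by (simp add: E_eq_iff)
  finally have "int p ^ s dvd int p * c + c * (q * int (p choose 2))"
    by (simp only: S mult.assoc)
  also have "int p * c + c * (q * int (p choose 2)) = int p * c * (1 + int p * r)"
    unfolding r by (simp add: algebra_simps)
  finally have "int p ^ s dvd int p * c * (1 + int p * r)" .
  \<comment> \<open>The factor 1 + pr is a unit modulo p^s and can be cancelled.\<close>
  moreover have "coprime (int p) (1 + int p * r)"
    using gcd_add_mult[of "int p" r 1] by (simp add: coprime_iff_gcd_eq_1 algebra_simps)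
  ultimately show ?thesis
    by (simp add: coprime_dvd_mult_left_iff)
qed

text \<open>For s \<ge> 1 the condition says that p^(s-1) divides c. Only c modulo p^s matters,
  which leaves the p residues t p^(s-1).\<close>

lemma B_cases:
  assumes s: "s \<le> \<alpha> - 1" and c: "int p ^ s dvd int p * c"
  obtains "B s c = carrier G" | t where "s \<ge> 1" "t < p" "B s c = BB (s, t)"
proof (cases s)
  case 0
  have "B s c = carrier G"
    unfolding carrier_eq B_def 0 by auto
  then show thesis by (rule that)
next
  case (Suc r)
  then have "int p ^ r dvd c" using c p_pos by simp
  then obtain d where d: "c = int p ^ r * d" by blast
  define t where "t = nat (d mod int p)"
  have t: "int t = d mod int p" using p_pos by (simp add: t_def)
  then have "int p dvd d - int t" by (simp add: minus_mod_eq_mult_div)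
  then have "int p * int p ^ r dvd (d - int t) * int p ^ r" by (rule mult_dvd_mono) simp
  then have cd: "int p ^ s dvd c - int t * int p ^ r"
    by (simp add: d Suc algebra_simps)
  have "int p ^ s dvd x - c * j \<longleftrightarrow> int p ^ s dvd x - int t * int p ^ r * j" for x j
  proof -
    have "x - int t * int p ^ r * j = x - c * j + (c - int t * int p ^ r) * j"
      by (simp add: algebra_simps)
    then show ?thesis using cd by (simp only: dvd_add_left_iff dvd_mult2)
  qed
  then have "B s c = BB (s, t)" by (simp add: B_def BB_def Suc)
  moreover have "t < p" using pos_mod_bound[of "int p" d] p_pos t by linarith
  ultimately show thesis using that(2)[of t] Suc by simp
qed

lemma BB_condition: "s \<ge> 1 \<Longrightarrow> int p ^ s dvd int p * (int t * int p ^ (s - 1))"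
  by (cases s) auto

lemma E_in_BB_iff:
  assumes "s \<in> {1..\<alpha> - 1}"
  shows "E x j \<in> BB (s, t) \<longleftrightarrow> int p ^ s dvd x - int t * int p ^ (s - 1) * j"
  unfolding BB_def prod.case
  by (rule E_in_B_iff) (use assms BB_condition in auto)

lemma subgroup_BB: "s \<in> {1..\<alpha> - 1} \<Longrightarrow> subgroup (BB (s, t)) G"
  unfolding BB_def prod.case by (rule subgroup_B) (use BB_condition in auto)

lemma power_eqI: "(\<And>x. int p ^ s dvd x \<longleftrightarrow> int p ^ r dvd x) \<Longrightarrow> s = r"
  using p_pos dvd_power_iff[of "int p" s r] dvd_power_iff[of "int p" r s] by fastforce

lemma inj_on_A: "inj_on A {..\<alpha> - 1}"
proof (rule inj_onI)
  fix s r assume sr: "s \<in> {..\<alpha> - 1}" "r \<in> {..\<alpha> - 1}" "A s = A r"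
  then have "E x 0 \<in> A s \<longleftrightarrow> E x 0 \<in> A r" for x by simp
  then show "s = r" using sr(1,2) by (intro power_eqI) (simp add: E_in_A_iff)
qed

text \<open>The intersection with <a> determines s, and the elements of the form a^x b determine t
  modulo p.\<close>

lemma inj_on_BB: "inj_on BB ({1..\<alpha> - 1} \<times> {..<p})"
proof (rule inj_onI, clarify)
  fix s r t u assume sr: "s \<in> {1..\<alpha> - 1}" "r \<in> {1..\<alpha> - 1}" and tu: "t < p" "u < p"
    and eq: "BB (s, t) = BB (r, u)"
  have "E x 0 \<in> BB (s, t) \<longleftrightarrow> E x 0 \<in> BB (r, u)" for x by (simp only: eq)
  then have s: "s = r" unfolding E_in_BB_iff[OF sr(1)] E_in_BB_iff[OF sr(2)]
    by (intro power_eqI) simp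
  have "E (int t * int p ^ (s - 1)) 1 \<in> BB (r, u)"
    unfolding eq[symmetric] by (simp add: E_in_BB_iff[OF sr(1)])
  then have "int p * int p ^ (s - 1) dvd (int t - int u) * int p ^ (s - 1)"
    using sr(1) unfolding s[symmetric] E_in_BB_iff[OF sr(1)]
    by (cases s) (auto simp: algebra_simps)
  then have "int p dvd int t - int u" using p_pos by simp
  then have "int t mod int p = int u mod int p" by (simp add: mod_eq_dvd_iff)
  with tu s show "s = r \<and> t = u" by simp
qed

lemma A_neq_BB: "s \<le> \<alpha> - 1 \<Longrightarrow> r \<in> {1..\<alpha> - 1} \<Longrightarrow> A s \<noteq> BB (r, t)"
proof
  assume s: "s \<le> \<alpha> - 1" and r: "r \<in> {1..\<alpha> - 1}" and eq: "A s = BB (r, t)"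
  have "E (int t * int p ^ (r - 1)) 1 \<in> A s" unfolding eq by (simp add: E_in_BB_iff[OF r])
  then show False using p_pos by (simp add: E_in_A_iff[OF s])
qed

lemma card_normals: "finite normals" "card normals = (\<alpha> - 1) + (\<alpha> - 2) * p"
proof -
  have "card (A ` {..\<alpha> - 2}) = \<alpha> - 1"
    using \<alpha> by (subst card_image) (auto intro: inj_on_subset[OF inj_on_A])
  moreover have "card (BB ` ({1..\<alpha> - 2} \<times> {..<p})) = (\<alpha> - 2) * p"
    by (subst card_image) (auto simp: card_cartesian_product intro!: inj_on_subset[OF inj_on_BB])
  moreover have "A ` {..\<alpha> - 2} \<inter> BB ` ({1..\<alpha> - 2} \<times> {..<p}) = {}"
    using A_neq_BB by fastforce
  ultimately show "finite normals" "card normals = (\<alpha> - 1) + (\<alpha> - 2) * p"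
    unfolding normals_def by (simp_all add: card_Un_disjoint)
qed

lemma A_last: "A (\<alpha> - 1) = {\<one>}"
proof -
  have "E x j = \<one> \<longleftrightarrow> E x j \<in> A (\<alpha> - 1)" for x j
    unfolding E_in_A_iff[OF order_refl] by (simp add: one_eq E_eq_iff)
  then show ?thesis
    by (intro subgroup_eqI_E[OF subgroup_A[OF order_refl] triv_subgroup]) simp
qed

lemma normalsD:
  assumes "H \<in> normals"
  shows "H \<lhd> G" "H \<noteq> {\<one>}" "H \<noteq> carrier G"
proof -
  have *: "H \<lhd> G \<and> H \<noteq> {\<one>} \<and> H \<noteq> carrier G"
    using assms unfolding normals_def
  proof (elim UnE imageE; clarify)
    fix s assume s: "s \<le> \<alpha> - 2"
    then have s': "s \<in> {..\<alpha> - 1}" "\<alpha> - 1 \<in> {..\<alpha> - 1}" "s \<noteq> \<alpha> - 1" using \<alpha> by auto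
    then have "A s \<noteq> {\<one>}"
      unfolding A_last[symmetric] using inj_onD[OF inj_on_A, of s "\<alpha> - 1"] by blast
    \<comment> \<open>Properness is witnessed by b here, and by a for the second family, where s
      \<ge> 1.\<close>
    moreover have "E 0 1 \<notin> A s" using p_pos s' by (simp add: E_in_A_iff)
    then have "A s \<noteq> carrier G" using E_closed by blast
    moreover have "A s \<lhd> G" using s' by (intro normal_A) simp
    ultimately show "A s \<lhd> G \<and> A s \<noteq> {\<one>} \<and> A s \<noteq> carrier G"
      by blast
  next
    fix s t assume s: "s \<in> {1..\<alpha> - 2}" and t: "t < p"
    then have s': "s \<in> {1..\<alpha> - 1}" by auto
    have "\<not> int p ^ s dvd 1" using one_less_power[OF p_pos, of s] s by auto
    then have "E 1 0 \<notin> BB (s, t)" by (simp add: E_in_BB_iff[OF s'])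
    then have "BB (s, t) \<noteq> carrier G" using E_closed by blast
    moreover have "BB (s, t) \<lhd> G"
      unfolding BB_def prod.case by (rule normal_B) (use s BB_condition in auto)
    moreover have "BB (s, t) \<noteq> {\<one>}"
      using A_neq_BB[OF order_refl s', of t] unfolding A_last by (rule not_sym)
    ultimately show "BB (s, t) \<lhd> G \<and> BB (s, t) \<noteq> {\<one>} \<and> BB (s, t) \<noteq> carrier G"
      by blast
  qed
  then show "H \<lhd> G" "H \<noteq> {\<one>}" "H \<noteq> carrier G" by auto
qed

text \<open>The trivial subgroup, the whole group and all of \<open>normals\<close> are normal, so
  normality alone tells them from \<open>W\<close>. The two cases of the theorem differ only in the
  list \<open>W\<close>.\<close>

lemma vertices:
  assumes W: "\<forall>H\<in>W. subgroup H G \<and> \<not> H \<lhd> G"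
    and cases: "\<forall>H. subgroup H G \<longrightarrow> H = {\<one>} \<or> H = carrier G \<or> H \<in> normals \<union> W"
  shows "{H. subgroup H G \<and> H \<noteq> {\<one>} \<and> H \<noteq> carrier G} = normals \<union> W"
    and "{H. subgroup H G \<and> H \<noteq> carrier G \<and> \<not> H \<lhd> G} = W"
    and "normals \<inter> W = {}"
proof -
  have one: "{\<one>} \<lhd> G" using normal_A[OF order_refl] by (simp only: A_last)
  have carr: "carrier G \<lhd> G" by (simp add: normal_inv_iff subgroup_self)
  have H: "(subgroup H G \<and> H \<noteq> {\<one>} \<and> H \<noteq> carrier G \<longleftrightarrow> H \<in> normals \<union> W) \<and>
      (subgroup H G \<and> H \<noteq> carrier G \<and> \<not> H \<lhd> G \<longleftrightarrow> H \<in> W) \<and> H \<notin> normals \<inter> W" for H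
  proof -
    have "H \<in> W \<Longrightarrow> subgroup H G" "H \<in> W \<Longrightarrow> \<not> H \<lhd> G"
      using W by blast+
    moreover have "\<not> H \<lhd> G \<Longrightarrow> H \<noteq> {\<one>}" "\<not> H \<lhd> G \<Longrightarrow> H \<noteq> carrier G"
      using one carr by metis+
    moreover have "subgroup H G \<longrightarrow> H = {\<one>} \<or> H = carrier G \<or> H \<in> normals \<union> W"
      by (rule cases[THEN spec])
    moreover note normalsD[of H] normal_imp_subgroup[of H G]
    ultimately show ?thesis by (cases "H \<in> W"; cases "H \<in> normals"; cases "H \<lhd> G") simp_all
  qed
  show "{H. subgroup H G \<and> H \<noteq> {\<one>} \<and> H \<noteq> carrier G} = normals \<union> W"
    using H by blast
  show "{H. subgroup H G \<and> H \<noteq> carrier G \<and> \<not> H \<lhd> G} = W"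
    using H by blast
  show "normals \<inter> W = {}" using H by blast
qed

section \<open>The graphs when the order is not 8\<close>

lemma permutability_graphs_not8:
  assumes not8: "p ^ \<alpha> \<noteq> 8"
  shows "nonnormal_permutability_graph G \<simeq>\<^sub>g complete_graph p"
    and "permutability_graph G \<simeq>\<^sub>g complete_graph ((\<alpha> - 1) * (p + 1))"
proof -
  define W where "W = BB ` ({\<alpha> - 1} \<times> {..<p})"
  have \<alpha>': "\<alpha> - 1 \<in> {1..\<alpha> - 1}" using \<alpha> by auto
  have W: "subgroup H G \<and> \<not> H \<lhd> G" if "H \<in> W" for H
  proof -
    obtain t where H: "H = BB (\<alpha> - 1, t)" using \<open>H \<in> W\<close> unfolding W_def by blast
    have "\<not> H \<lhd> G"
    proof (rule not_normal_if_trivial_on_a)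
      show "E (int t * int p ^ (\<alpha> - 1 - 1)) 1 \<in> H"
        unfolding H E_in_BB_iff[OF \<alpha>'] by simp
      show "n dvd x" if "E x 0 \<in> H" for x
        using that unfolding H E_in_BB_iff[OF \<alpha>'] by simp
    qed
    then show ?thesis using subgroup_BB[OF \<alpha>'] H by blast
  qed
  have cases: "H = {\<one>} \<or> H = carrier G \<or> H \<in> normals \<union> W" if H: "subgroup H G" for H
    using H
  proof (cases rule: subgroup_cases)
    case (A s)
    show ?thesis
    proof (cases "s = \<alpha> - 1")
      case False
      with A have "s \<le> \<alpha> - 2" by simp
      with A show ?thesis unfolding normals_def by blast
    qed (use A A_last in simp)
  next
    case (twisted s c)
    have c: "int p ^ s dvd int p * c"
      by (rule twisted_condition[OF not8 H twisted(2,3)])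
    have "H = B s c" by (rule twisted_subgroup_eq_B[OF H twisted c])
    moreover have "B s c \<in> normals \<union> W" if "s \<ge> 1" "t < p" "B s c = BB (s, t)" for t
    proof (cases "s = \<alpha> - 1")
      case False
      with twisted(1) that have "(s, t) \<in> {1..\<alpha> - 2} \<times> {..<p}" by auto
      then show ?thesis unfolding that normals_def by blast
    qed (use that in \<open>auto simp: W_def\<close>)
    ultimately show ?thesis by - (rule B_cases[OF twisted(1) c]; blast)
  qed
  have "\<forall>H\<in>W. subgroup H G \<and> \<not> H \<lhd> G"
    and "\<forall>H. subgroup H G \<longrightarrow> H = {\<one>} \<or> H = carrier G \<or> H \<in> normals \<union> W"
    using W cases by blast+
  note V = vertices[OF this]
  have card: "finite W" "card W = p"
    using \<alpha>' unfolding W_def by (simp, subst card_image) (auto intro: inj_on_subset[OF inj_on_BB])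
  have perm: "H <#> K = K <#> H" if "H \<in> W" "K \<in> W" for H K
  proof -
    have "g \<otimes> h = h \<otimes> g" if "g \<in> H" "h \<in> K" for g h
    proof -
      \<comment> \<open>At s = \<alpha>-1 the step p^(s-1) equals \<open>q\<close>, so every
        a-exponent in such a subgroup is a multiple of \<open>q\<close>.\<close>
      have *: "\<exists>x j. g = E (q * x) j" if "g \<in> K" "K \<in> W" for g K
      proof -
        obtain t where K: "K = BB (\<alpha> - 1, t)" using \<open>K \<in> W\<close> unfolding W_def by blast
        have "g \<in> carrier G"
          using subgroup.mem_carrier[OF subgroup_BB[OF \<alpha>']] \<open>g \<in> K\<close> K by blast
        then obtain x j where g: "g = E x j" by (rule carrierE)
        then have "n dvd x - int t * int p ^ (\<alpha> - 1 - 1) * j"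
          using that(1) unfolding K by (simp only: E_in_BB_iff[OF \<alpha>'])
        moreover have "\<alpha> - 1 - 1 = \<alpha> - 2" by simp
        moreover have "q dvd n" unfolding pq[symmetric] by simp
        ultimately have "q dvd x - int t * q * j" by (metis dvd_trans)
        from dvd_add[OF this, of "int t * q * j"] have "q dvd x" by simp
        then show ?thesis using g by blast
      qed
      obtain x j y k where "g = E (q * x) j" "h = E (q * y) k"
        using *[OF \<open>g \<in> H\<close> \<open>H \<in> W\<close>] *[OF \<open>h \<in> K\<close> \<open>K \<in> W\<close>] by blast
      \<comment> \<open>The two products differ only in their twists, each of which carries the
        factor q^2.\<close>
      moreover have "n dvd q * x + q * y + j * (q * y) * q - (q * y + q * x + k * (q * x) * q)"
      proof -
        have "q * x + q * y + j * (q * y) * q - (q * y + q * x + k * (q * x) * q) =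
          q * q * (j * y - k * x)" by (simp add: algebra_simps)
        then show ?thesis using n_dvd by simp
      qed
      ultimately show ?thesis by (simp add: E_mult E_eq_iff)
    qed
    then show ?thesis unfolding set_mult_def by fastforce
  qed
  have "permutability_graph_on G W \<simeq>\<^sub>g complete_graph (card W)"
    using card(1) perm by (rule permutability_graph_on_complete)
  then show "nonnormal_permutability_graph G \<simeq>\<^sub>g complete_graph p"
    unfolding nonnormal_permutability_graph_def V(2) card(2) .
  have "card (normals \<union> W) = (\<alpha> - 1) + (\<alpha> - 2) * p + p"
    using V(3) card card_normals by (simp add: card_Un_disjoint)
  also have "\<dots> = (\<alpha> - 1) * (p + 1)"
  proof -
    obtain m where "\<alpha> = m + 2" using that[of "\<alpha> - 2"] \<alpha> by simp
    then show ?thesis by (simp add: algebra_simps)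
  qed
  finally have c: "card (normals \<union> W) = (\<alpha> - 1) * (p + 1)" .
  have perm': "H <#> K = K <#> H" if HK: "H \<in> normals \<union> W" "K \<in> normals \<union> W" for H K
  proof -
    have "subgroup H G" "subgroup K G"
      using HK W normalsD normal_imp_subgroup by blast+
    \<comment> \<open>Either one of the two subgroups is normal, or both lie in
      \<open>W\<close>.\<close>
    then show ?thesis
      using HK perm[of H K] normalsD(1) commut_normal[of H K] commut_normal[of K H] by auto
  qed
  have "finite (normals \<union> W)" using card card_normals by simp
  then have "permutability_graph_on G (normals \<union> W) \<simeq>\<^sub>g complete_graph (card (normals \<union> W))"
    using perm' by (rule permutability_graph_on_complete)
  then show "permutability_graph G \<simeq>\<^sub>g complete_graph ((\<alpha> - 1) * (p + 1))"
    unfolding permutability_graph_def V(1) c .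
qed

section \<open>The group of order 8\<close>

definition C :: "int \<Rightarrow> 'a set" where
  "C c = {\<one>, E c 1}"

lemma permutability_graphs_8:
  assumes p2: "p = 2" and \<alpha>3: "\<alpha> = 3"
  shows "nonnormal_permutability_graph G \<simeq>\<^sub>g two_K2"
    and "permutability_graph G \<simeq>\<^sub>g join_graph (complete_graph 4) two_K2"
proof -
  have mult: "E i j \<otimes> E k l = E (i + k + j * k * 2) (j + l)" for i j k l
    by (simp add: E_mult p2 \<alpha>3)
  have eq: "E i j = E k l \<longleftrightarrow> 4 dvd i - k \<and> 2 dvd j - l" for i j k l
    by (simp add: E_eq_iff p2 \<alpha>3)
  have C_eq: "C i = C k \<longleftrightarrow> 4 dvd i - k" for i k
    unfolding C_def one_eq by (auto simp: doubleton_eq_iff eq)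
  have mem_C: "E x j \<in> C c \<longleftrightarrow> (if even j then 4 dvd x else 4 dvd x - c)" for x j c
    by (auto simp: C_def one_eq eq)
  have subgroup_C: "subgroup (C c) G" for c
  proof (rule subgroupI)
    show "C c \<subseteq> carrier G" "C c \<noteq> {}" by (auto simp: C_def)
    \<comment> \<open>The twist doubles the exponent 2c to 4c, so a^c b is an involution for every
      c; this is why c is unrestricted here.\<close>
    have 1: "E c 1 \<otimes> E c 1 = \<one>" by (simp add: mult one_eq eq)
    then have "inv (E c 1) = E c 1" by (intro inv_equality) auto
    then show "inv g \<in> C c" if "g \<in> C c" for g using that by (auto simp: C_def)
    show "g \<otimes> h \<in> C c" if "g \<in> C c" "h \<in> C c" for g h
      using that 1 by (auto simp: C_def)
  qed
  define W where "W = C ` {0, 1, 2, 3}"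
  have C_W: "C c \<in> W" for c
  proof -
    define d where "d = c mod 4"
    have "C c = C d" by (simp add: C_eq d_def minus_mod_eq_mult_div)
    moreover have "d = 0 \<or> d = 1 \<or> d = 2 \<or> d = 3" unfolding d_def by presburger
    ultimately show ?thesis unfolding W_def by auto
  qed
  have W: "subgroup H G \<and> \<not> H \<lhd> G" if "H \<in> W" for H
  proof -
    obtain c where H: "H = C c" using \<open>H \<in> W\<close> unfolding W_def by blast
    have "\<not> H \<lhd> G"
    proof (rule not_normal_if_trivial_on_a)
      show "E c 1 \<in> H" by (simp add: H C_def)
      show "n dvd x" if "E x 0 \<in> H" for x
        using that by (simp add: H mem_C p2 \<alpha>3)
    qed
    then show ?thesis using subgroup_C H by blast
  qed
  have cases: "H = {\<one>} \<or> H = carrier G \<or> H \<in> normals \<union> W" if H: "subgroup H G" for H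
    using H
  proof (cases rule: subgroup_cases)
    case (A s)
    show ?thesis
    proof (cases "s = \<alpha> - 1")
      case False
      with A have "s \<le> \<alpha> - 2" by simp
      with A show ?thesis unfolding normals_def by blast
    qed (use A A_last in simp)
  next
    case (twisted s c)
    show ?thesis
    \<comment> \<open>For s \<le> 1 the condition on c is automatic, and the general classification
      applies. Only s = 2, trivial intersection with <a>, needs separate treatment.\<close>
    proof (cases "s \<le> 1")
      case True
      then have c: "int p ^ s dvd int p * c" by (cases s) auto
      have "H = B s c" by (rule twisted_subgroup_eq_B[OF H twisted c])
      moreover have "B s c \<in> normals" if "s \<ge> 1" "t < p" "B s c = BB (s, t)" for t
      proof -
        have "(s, t) \<in> {1..\<alpha> - 2} \<times> {..<p}" using True that \<alpha>3 by auto
        then show ?thesis unfolding that normals_def by blast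
      qed
      ultimately show ?thesis by - (rule B_cases[OF twisted(1) c]; blast)
    next
      case False
      then have "s = 2" using twisted(1) \<alpha>3 by simp
      then have S: "E x 0 \<in> H \<longleftrightarrow> 4 dvd x" for x
        using twisted(3)[of x] by (simp add: p2)
      have S': "E x 0 \<in> H \<longleftrightarrow> int p ^ 2 dvd x" for x
        using S[of x] by (simp add: p2)
      have "H = C c"
      proof (rule subgroup_eqI_E[OF H subgroup_C])
        fix x j
        show "E x j \<in> H \<longleftrightarrow> E x j \<in> C c"
        proof (cases "even j")
          case True
          then have "E x j = E x 0" by (simp add: eq)
          then show ?thesis using True by (simp add: S mem_C)
        next
          case False
          then have "E x j = E x 1" by (simp add: eq)
          then show ?thesis
            using False mem_subgroup_iff[OF H twisted(2) S', of x] by (simp add: mem_C p2)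
        qed
      qed
      then show ?thesis using C_W by simp
    qed
  qed
  have "\<forall>H\<in>W. subgroup H G \<and> \<not> H \<lhd> G"
    and "\<forall>H. subgroup H G \<longrightarrow> H = {\<one>} \<or> H = carrier G \<or> H \<in> normals \<union> W"
    using W cases by blast+
  note V = vertices[OF this]
  have commute: "C i <#> C k = C k <#> C i \<longleftrightarrow> even (i - k)" for i k
  proof -
    \<comment> \<open>The last entry is a^i b a^k b, whose a-exponent is i + k + 2k.\<close>
    have C2: "C i <#> C k = {E 0 0, E k 1, E i 1, E (i + 3 * k) 2}" for i k
      by (auto simp: C_def set_mult_def mult one_eq algebra_simps)
    show ?thesis
    proof
      assume "C i <#> C k = C k <#> C i"
      \<comment> \<open>An even b-exponent can only match the first or the last entry, and either
        match makes i - k even.\<close>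
      then have "E (i + 3 * k) 2 \<in> {E 0 0, E i 1, E k 1, E (k + 3 * i) 2}"
        unfolding C2 by blast
      then have "4 dvd i + 3 * k \<or> 4 dvd i + 3 * k - (k + 3 * i)"
        by (auto simp: eq)
      then show "even (i - k)" by presburger
    next
      assume "even (i - k)"
      then have "4 dvd i + 3 * k - (k + 3 * i)" by presburger
      then have "E (i + 3 * k) 2 = E (k + 3 * i) 2" by (simp add: eq)
      then show "C i <#> C k = C k <#> C i" unfolding C2 by auto
    qed
  qed
  have W_iso: "permutability_graph_on G W \<simeq>\<^sub>g two_K2"
  proof (rule graph_isoI_inverse[OF pair_wf_digraph_permutability_graph_on])
    show "pair_wf_digraph two_K2"
      unfolding two_K2_def
      by (intro pair_wf_digraph_disjoint_union_graph pair_wf_digraph_complete_graph)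
    \<comment> \<open>The two edges are the parity classes of c.\<close>
    define f where "f = case_sum (\<lambda>i. C (2 * int i)) (\<lambda>i. C (2 * int i + 1))"
    have "{..<2::nat} = {0, 1}" by auto
    then have verts: "pverts two_K2 = {Inl 0, Inl 1, Inr 0, Inr 1}"
      by (auto simp: two_K2_def disjoint_union_graph_def complete_graph_def)
    have "{(u, v). u < 2 \<and> v < (2::nat) \<and> u \<noteq> v} = {(0, 1), (1, 0)}" by auto
    then have arcs: "parcs two_K2 =
        {(Inl 0, Inl 1), (Inl 1, Inl 0), (Inr 0, Inr 1), (Inr 1, Inr 0)}"
      by (auto simp: two_K2_def disjoint_union_graph_def complete_graph_def)
    show "bij_betw f (pverts two_K2) (pverts (permutability_graph_on G W))"
    proof (rule bij_betw_imageI)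
      show "inj_on f (pverts two_K2)" unfolding verts inj_on_def by (simp add: f_def C_eq)
      show "f ` pverts two_K2 = pverts (permutability_graph_on G W)"
        unfolding verts W_def permutability_graph_on_def by (auto simp: f_def)
    qed
    show "parcs (permutability_graph_on G W) = map_prod f f ` parcs two_K2"
    proof -
      \<comment> \<open>Pulling the arcs back to indices turns adjacency into a finite check on 0,
        1, 2, 3.\<close>
      have image: "{(H, K). H \<in> C ` I \<and> K \<in> C ` I \<and> P H K} =
          (\<lambda>(i, k). (C i, C k)) ` {(i, k). i \<in> I \<and> k \<in> I \<and> P (C i) (C k)}" for I P
        by auto
      have "{(i, k). i \<in> {0, 1, 2, 3} \<and> k \<in> {0, 1, 2, 3} \<and> \<not> 4 dvd i - k \<and> even (i - k)} =
          {(0, 2), (2, 0), (1, 3), (3, 1 :: int)}"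
        by auto
      then have "parcs (permutability_graph_on G W) =
          (\<lambda>(i, k). (C i, C k)) ` {(0, 2), (2, 0), (1, 3), (3, 1)}"
        unfolding permutability_graph_on_def pair_pre_digraph.simps W_def image C_eq commute by simp
      then show ?thesis unfolding arcs by (simp add: f_def)
    qed
  qed
  show "nonnormal_permutability_graph G \<simeq>\<^sub>g two_K2"
    unfolding nonnormal_permutability_graph_def V(2) by (rule W_iso)
  have perm: "H <#> K = K <#> H" if "H \<in> normals" "K \<in> normals \<union> W" for H K
  proof -
    have "subgroup K G" using that(2) W normalsD(1) normal_imp_subgroup by blast
    then show ?thesis using commut_normal[of K H] normalsD(1)[OF that(1)] by simp
  qed
  have "permutability_graph_on G (normals \<union> W) \<simeq>\<^sub>g join_graph (complete_graph (card normals)) two_K2"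
    using card_normals(1) V(3) perm W_iso by (rule permutability_graph_on_join)
  then show "permutability_graph G \<simeq>\<^sub>g join_graph (complete_graph 4) two_K2"
    unfolding permutability_graph_def V(1) card_normals(2) by (simp add: p2 \<alpha>3)
qed

end

theorem theorem7p1:
  fixes p \<alpha> :: nat
  assumes "prime p" and "\<alpha> \<ge> 3"
  shows
    "(p ^ \<alpha> = 8 \<longrightarrow> nonnormal_permutability_graph (modular_group p \<alpha>) \<simeq>\<^sub>g two_K2) \<and>
     (p ^ \<alpha> \<noteq> 8 \<longrightarrow> nonnormal_permutability_graph (modular_group p \<alpha>) \<simeq>\<^sub>g complete_graph p) \<and>
     (p ^ \<alpha> = 8 \<longrightarrow>
        permutability_graph (modular_group p \<alpha>) \<simeq>\<^sub>g join_graph (complete_graph 4) two_K2) \<and>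
     (p ^ \<alpha> \<noteq> 8 \<longrightarrow>
        permutability_graph (modular_group p \<alpha>) \<simeq>\<^sub>g complete_graph ((\<alpha> - 1) * (p + 1)))"
proof -
  obtain E where "modular_p_group (modular_group p \<alpha>) p \<alpha> E"
    using ex_modular_p_group_modular_group[OF assms] by blast
  then interpret modular_p_group "modular_group p \<alpha>" p \<alpha> E .
  show ?thesis
  proof (cases "p ^ \<alpha> = 8")
    case True
    have "p dvd p ^ \<alpha>" using assms(2) by simp
    then have "p dvd 2 ^ 3" by (simp add: True)
    then have "p dvd 2" using assms(1) prime_dvd_power by blast
    then have p: "p = 2" using assms(1) by (simp add: primes_dvd_imp_eq)
    then have "(2::nat) ^ \<alpha> = 2 ^ 3" using True by simp
    then have "\<alpha> = 3" by (simp only: power_inject_exp)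
    with p True show ?thesis using permutability_graphs_8 by simp
  next
    case False
    then show ?thesis using permutability_graphs_not8 by simp
  qed
qed

end
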